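(* Let $d\ge1$ and $r\ge3$ be integers and let $G=G_{r,d}$. Then $\operatorname{reg}(I_G)=r$.
   Context: $\mathbb{K}$ is an algebraically closed field of characteristic $0$. For integers $d\ge1$, $r\ge3$, the graph $G_{r,d}$ has vertex set $\{x_1,x_2,y_1,\ldots,y_d,z_1,\ldots,z_{2r-3}\}$ and edge set $$\{\{x_i,y_j\}: 1\le i\le2,\ 1\le j\le d\}\cup\{\{x_1,z_1\},\{z_1,z_2\},\{z_2,z_3\},\ldots,\{z_{2r-4},z_{2r-3}\},\{z_{2r-3},x_2\}\},$$ i.e. a complete bipartite graph $K_{2,d}$ together with a path of length $2r-2$ joining $x_1$ and $x_2$. For a finite simple graph $G$ with vertex set $V$ and edge set $E(G)$ (vertices and edges also naming variables of degree $1$), the toric ideal $I_G\subseteq\mathbb{K}[E(G)]$ is the kernel of the $\mathbb{K}$-algebra homomorphism $\mathbb{K}[E(G)]\to\mathbb{K}[V]$ sending each edge $e=\{u,w\}$ to $uw$. $\operatorname{reg}$ denotes Castelnuovo–Mumford regularity. *)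

theory Defs
  imports
    "HOL-Library.Poly_Mapping"
    "HOL-Computational_Algebra.Polynomial"
    "Jordan_Normal_Form.Matrix_Kernel"
begin

section \<open>Polynomial rings\<close>

type_synonym ('v, 'k) mpoly = "('v \<Rightarrow>\<^sub>0 nat) \<Rightarrow>\<^sub>0 'k"

text \<open>The type provides a variable for every element of \<open>'v\<close>; \<open>poly_ring X\<close> is the subring
  \<open>\<bbbK>[X]\<close> of the polynomials that only involve variables from \<open>X\<close>.\<close>

definition poly_ring :: "'v set \<Rightarrow> ('v, 'k::comm_ring_1) mpoly set" where
  "poly_ring X = {p. \<forall>m \<in> Poly_Mapping.keys p. Poly_Mapping.keys m \<subseteq> X}"

definition Const :: "'k::comm_ring_1 \<Rightarrow> ('v, 'k) mpoly" where
  "Const c = Poly_Mapping.single 0 c"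

definition Var :: "'v \<Rightarrow> ('v, 'k::comm_ring_1) mpoly" where
  "Var x = Poly_Mapping.single (Poly_Mapping.single x 1) 1"

definition total_deg :: "('v \<Rightarrow>\<^sub>0 nat) \<Rightarrow> nat" where
  "total_deg m = (\<Sum>x \<in> Poly_Mapping.keys m. Poly_Mapping.lookup m x)"

text \<open>The \<open>\<bbbK>\<close>-algebra homomorphism sending each variable \<open>x\<close> to \<open>f x\<close>.\<close>

definition poly_subst :: "('v \<Rightarrow> ('w, 'k::comm_ring_1) mpoly) \<Rightarrow> ('v, 'k) mpoly \<Rightarrow> ('w, 'k) mpoly" where
  "poly_subst f p = (\<Sum>m \<in> Poly_Mapping.keys p. Const (Poly_Mapping.lookup p m) *
     (\<Prod>x \<in> Poly_Mapping.keys m. f x ^ Poly_Mapping.lookup m x))"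


section \<open>Graphs and toric ideals\<close>

type_synonym 'v graph = "'v set \<times> 'v set set"

definition finite_simple_graph :: "'v graph \<Rightarrow> bool" where
  "finite_simple_graph G \<longleftrightarrow> finite (fst G) \<and> (\<forall>e \<in> snd G. e \<subseteq> fst G \<and> card e = 2)"

definition toric_ideal :: "'v graph \<Rightarrow> ('v set, 'k::comm_ring_1) mpoly set" where
  "toric_ideal G = {p \<in> poly_ring (snd G). poly_subst (\<lambda>e. \<Prod>v \<in> e. Var v) p = 0}"

datatype vertex = vx nat | vy nat | vz nat

definition G_rd :: "nat \<Rightarrow> nat \<Rightarrow> vertex graph" where
  "G_rd r d =
    (vx ` {1..2} \<union> vy ` {1..d} \<union> vz ` {1..2*r-3},
     {{vx i, vy j} | i j. i \<in> {1..2} \<and> j \<in> {1..d}}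
       \<union> {{vx 1, vz 1}} \<union> {{vz k, vz (k+1)} | k. k \<in> {1..2*r-4}} \<union> {{vz (2*r-3), vx 2}})"

lemma finite_simple_graph_G_rd:
  assumes "r \<ge> 3"
  shows "finite_simple_graph (G_rd r d)"
  using assms by (auto simp: finite_simple_graph_def G_rd_def card_insert_if)


section \<open>Minimal graded free resolutions and regularity\<close>

text \<open>A sequence of graded free modules over \<open>S = \<bbbK>[X]\<close> with maps
  \[ \cdots \to F_2 \to F_1 \to F_0 \to S. \]
  If \<open>shifts F i = [b\<^sub>0, \<dots>, b\<^sub>n\<^sub>-\<^sub>1]\<close>, then \<open>F\<^sub>i = S(-b\<^sub>0) \<oplus> \<cdots> \<oplus> S(-b\<^sub>n\<^sub>-\<^sub>1)\<close>, so the \<open>q\<close>-th basis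
  vector of \<open>F\<^sub>i\<close> has degree \<open>b\<^sub>q\<close>. The matrix \<open>diff F 0\<close> represents \<open>F\<^sub>0 \<rightarrow> S\<close>, and \<open>diff F (Suc i)\<close>
  represents \<open>F\<^sub>i\<^sub>+\<^sub>1 \<rightarrow> F\<^sub>i\<close>; matrices act on column vectors.\<close>

record (overloaded) ('v, 'k) graded_free_seq =
  shifts :: "nat \<Rightarrow> int list"
  diff :: "nat \<Rightarrow> ('v, 'k) mpoly mat"

definition free_module :: "'v set \<Rightarrow> nat \<Rightarrow> ('v, 'k::comm_ring_1) mpoly vec set" where
  "free_module X n = {v \<in> carrier_vec n. set\<^sub>v v \<subseteq> poly_ring X}"

text \<open>\<open>A\<close> represents a degree-preserving map \<open>\<Oplus>\<^sub>q S(-b\<^sub>q) \<rightarrow> \<Oplus>\<^sub>p S(-a\<^sub>p)\<close>: its \<open>(p,q)\<close> entry is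
  homogeneous of degree \<open>b\<^sub>q - a\<^sub>p\<close> (hence zero if this number is negative).\<close>

definition graded_map :: "'v set \<Rightarrow> int list \<Rightarrow> int list \<Rightarrow> ('v, 'k::comm_ring_1) mpoly mat \<Rightarrow> bool" where
  "graded_map X a b A \<longleftrightarrow>
     A \<in> carrier_mat (length a) (length b) \<and> elements_mat A \<subseteq> poly_ring X \<and>
     (\<forall>p < length a. \<forall>q < length b. \<forall>m \<in> Poly_Mapping.keys (A $$ (p, q)).
        int (total_deg m) = b ! q - a ! p)"

text \<open>A graded free resolution of the homogeneous ideal \<open>I \<subseteq> \<bbbK>[X]\<close>, viewed as a module:
  \<open>\<cdots> \<rightarrow> F\<^sub>1 \<rightarrow> F\<^sub>0 \<rightarrow> I \<rightarrow> 0\<close> is exact.\<close>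

definition graded_free_resolution ::
  "'v set \<Rightarrow> ('v, 'k::comm_ring_1) mpoly set \<Rightarrow> ('v, 'k) graded_free_seq \<Rightarrow> bool" where
  "graded_free_resolution X I F \<longleftrightarrow>
     graded_map X [0] (shifts F 0) (diff F 0) \<and>
     (\<forall>i. graded_map X (shifts F i) (shifts F (Suc i)) (diff F (Suc i))) \<and>
     (\<lambda>v. diff F 0 *\<^sub>v v) ` free_module X (length (shifts F 0)) = (\<lambda>f. vec 1 (\<lambda>_. f)) ` I \<and>
     (\<forall>i. (\<lambda>v. diff F (Suc i) *\<^sub>v v) ` free_module X (length (shifts F (Suc i))) =
          mat_kernel (diff F i) \<inter> free_module X (length (shifts F i)))"

text \<open>Minimality: the image of \<open>F\<^sub>i\<^sub>+\<^sub>1\<close> lies in \<open>(X) F\<^sub>i\<close>, that is, all entries of the differentials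
  lie in the ideal generated by the variables. The augmentation \<open>diff F 0\<close> is not a differential.\<close>

definition minimal_graded_free_resolution ::
  "'v set \<Rightarrow> ('v, 'k::comm_ring_1) mpoly set \<Rightarrow> ('v, 'k) graded_free_seq \<Rightarrow> bool" where
  "minimal_graded_free_resolution X I F \<longleftrightarrow>
     graded_free_resolution X I F \<and>
     (\<forall>i. \<forall>f \<in> elements_mat (diff F (Suc i)). Poly_Mapping.lookup f 0 = 0)"

text \<open>For a homogeneous ideal over a field and finite \<open>X\<close>, a minimal graded free resolution exists
  and is unique up to isomorphism, so the choice below is immaterial:
  \<open>F\<^sub>i = \<Oplus>\<^sub>j S(-j)\<^bsup>\<beta>(i,j)\<^esup>\<close> for every minimal graded free resolution.\<close>

definition graded_betti :: "'v set \<Rightarrow> ('v, 'k::comm_ring_1) mpoly set \<Rightarrow> nat \<Rightarrow> int \<Rightarrow> nat" where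
  "graded_betti X I i j =
     count_list (shifts (SOME F. minimal_graded_free_resolution X I F) i) j"

text \<open>Castelnuovo--Mumford regularity of a nonzero homogeneous ideal \<open>I \<subseteq> \<bbbK>[X]\<close> (\<open>X\<close> finite);
  by Hilbert's syzygy theorem the maximum ranges over a finite nonempty set.\<close>

definition regularity :: "'v set \<Rightarrow> ('v, 'k::comm_ring_1) mpoly set \<Rightarrow> int" where
  "regularity X I = Max {j - int i | i j. graded_betti X I i j \<noteq> 0}"

end

theory Submission
  imports Defs
begin

text \<open>Put \<open>a\<^sub>j = {x\<^sub>1, y\<^sub>j}\<close> and \<open>b\<^sub>j = {x\<^sub>2, y\<^sub>j}\<close> for \<open>1 \<le> j \<le> d\<close>, and let \<open>a\<^sub>0\<close> and \<open>b\<^sub>0\<close> be the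
  products of the edges at the odd and at the even positions of the path from \<open>x\<^sub>1\<close> to \<open>x\<^sub>2\<close>; both
  have degree \<open>r - 1\<close>. In the ring of the vertices \<open>a\<^sub>j : b\<^sub>j = x\<^sub>1 : x\<^sub>2\<close> for all \<open>j\<close>, and in fact
  the toric ideal is generated by the \<open>2\<close>-minors of the \<open>2 \<times> (d + 1)\<close> matrix with these columns. As
  a module, this ideal is minimally resolved by the Eagon--Northcott complex: the \<open>i\<close>-th free module
  has a basis indexed by the sets \<open>T\<close> of \<open>i + 2\<close> columns, each with multiplicity \<open>i + 1\<close>, and the
  degree of a basis vector is the sum of the degrees of its columns, that is, \<open>i + 2\<close> if \<open>0 \<notin> T\<close>
  and \<open>i + r\<close> if \<open>0 \<in> T\<close>. So the degree minus \<open>i\<close> is \<open>2\<close> or \<open>r\<close>, and since \<open>r \<ge> 3\<close>, the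
  regularity is \<open>r\<close>; this value belongs to the generator for \<open>T = {0, 1}\<close>.

  Exactness of the Eagon--Northcott complex is proved by viewing it as the total complex of a double
  complex with the Koszul differentials \<open>\<partial>\<^sub>a\<close> and \<open>\<partial>\<^sub>b\<close> of the two rows (\<open>total_complex_exact\<close>).
  Besides the exactness of both Koszul complexes this needs the equality
  \<open>ker \<partial>\<^sub>a \<inter> ker \<partial>\<^sub>b = im \<partial>\<^sub>a\<partial>\<^sub>b\<close> in positive degrees (\<open>koszul_double_exact\<close>), which by induction
  on the number of columns reduces to the fact that the last coordinate of a common syzygy of the two
  rows lies in the ideal of the minors of the preceding columns. That ideal is a lattice ideal
  (\<open>lattice_ideal_eq_minors_ideal\<close>), so that suitable binomials are nonzerodivisors modulo it
  (\<open>lattice_ideal_nonzerodivisor\<close>). The same description as a lattice ideal identifies the ideal of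
  all minors with the toric ideal (\<open>toric_ideal_eq_lattice_ideal\<close>, \<open>vertex_exponent_G_rd_iff\<close>).

  The regularity is defined by an arbitrary minimal resolution. Comparison maps show that the shifts
  of a minimal resolution occur in every other resolution (\<open>shifts_minimal_subset\<close>), so that any two
  minimal resolutions have the same sets of shifts; these sets determine the regularity.\<close>

section \<open>The Koszul complex\<close>

text \<open>Elements of \<open>\<Lambda>\<^sup>m R\<^sup>n\<close> in coordinates with respect to the basis
  \<open>e\<^sub>T = e\<^sub>j\<^sub>1 \<and> \<dots> \<and> e\<^sub>j\<^sub>m\<close>, one vector for every \<open>T = {j\<^sub>1 < \<dots> < j\<^sub>m} \<subseteq> {..<n}\<close>.\<close>

definition ext_power :: "nat \<Rightarrow> nat \<Rightarrow> (nat set \<Rightarrow> 'a::comm_ring_1) set" where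
  "ext_power n m = {f. \<forall>T. f T \<noteq> 0 \<longrightarrow> T \<subseteq> {..<n} \<and> card T = m}"

definition koszul :: "nat \<Rightarrow> (nat \<Rightarrow> 'a::comm_ring_1) \<Rightarrow> (nat set \<Rightarrow> 'a) \<Rightarrow> nat set \<Rightarrow> 'a" where
  "koszul n a f T = (\<Sum>j\<in>{..<n} - T. (-1) ^ card {i\<in>T. i < j} * a j * f (insert j T))"

lemma ext_powerI: "(\<And>T. f T \<noteq> 0 \<Longrightarrow> T \<subseteq> {..<n} \<and> card T = m) \<Longrightarrow> f \<in> ext_power n m"
  by (auto simp: ext_power_def)

lemma ext_powerD: "f \<in> ext_power n m \<Longrightarrow> \<not> (T \<subseteq> {..<n} \<and> card T = m) \<Longrightarrow> f T = 0"
  by (auto simp: ext_power_def)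

lemma ext_power_zero: "(\<lambda>T. 0) \<in> ext_power n m"
  by (auto simp: ext_power_def)

lemma ext_power_add: "f \<in> ext_power n m \<Longrightarrow> g \<in> ext_power n m \<Longrightarrow> (\<lambda>T. f T + g T) \<in> ext_power n m"
  by (rule ext_powerI, rule ccontr) (simp add: ext_powerD)

lemma ext_power_diff: "f \<in> ext_power n m \<Longrightarrow> g \<in> ext_power n m \<Longrightarrow> (\<lambda>T. f T - g T) \<in> ext_power n m"
  by (rule ext_powerI, rule ccontr) (simp add: ext_powerD)

lemma ext_power_mult: "f \<in> ext_power n m \<Longrightarrow> (\<lambda>T. c * f T) \<in> ext_power n m"
  by (rule ext_powerI, rule ccontr) (simp add: ext_powerD)

lemma ext_power_Suc: "f \<in> ext_power n m \<Longrightarrow> f \<in> ext_power (Suc n) m"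
  by (fastforce simp: ext_power_def lessThan_Suc)

lemma koszul_in_ext_power:
  assumes "f \<in> ext_power n (Suc m)"
  shows "koszul n a f \<in> ext_power n m"
proof (rule ext_powerI)
  fix T assume "koszul n a f T \<noteq> 0"
  then obtain j where j: "j \<in> {..<n} - T" "f (insert j T) \<noteq> 0"
    unfolding koszul_def by (metis (no_types, lifting) sum.neutral mult_zero_right)
  then have *: "insert j T \<subseteq> {..<n}" "card (insert j T) = Suc m"
    using assms by (auto dest: ext_powerD simp: ext_power_def)
  then have "finite T" using finite_subset[of T "{..<n}"] by auto
  then show "T \<subseteq> {..<n} \<and> card T = m" using * j by auto
qed

lemma koszul_cong:
  "(\<And>j. j < n \<Longrightarrow> j \<notin> T \<Longrightarrow> f (insert j T) = g (insert j T)) \<Longrightarrow> koszul n a f T = koszul n a g T"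
  by (auto simp: koszul_def intro!: sum.cong)

lemma koszul_zero [simp]: "koszul n a (\<lambda>T. 0) = (\<lambda>T. 0)"
  by (auto simp: koszul_def)

lemma koszul_add: "koszul n a (\<lambda>T. f T + g T) = (\<lambda>T. koszul n a f T + koszul n a g T)"
  by (auto simp: koszul_def algebra_simps sum.distrib)

lemma koszul_diff: "koszul n a (\<lambda>T. f T - g T) = (\<lambda>T. koszul n a f T - koszul n a g T)"
  by (auto simp: koszul_def algebra_simps sum_subtractf)

lemma koszul_mult: "koszul n a (\<lambda>T. c * f T) = (\<lambda>T. c * koszul n a f T)"
  by (auto simp: koszul_def sum_distrib_left algebra_simps)

lemma koszul_uminus: "koszul n a (\<lambda>T. - f T) = (\<lambda>T. - koszul n a f T)"
  using koszul_mult[of n a "-1" f] by simp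

lemma koszul_coeff_add: "koszul n (\<lambda>j. a j + b j) f = (\<lambda>T. koszul n a f T + koszul n b f T)"
  by (auto simp: koszul_def algebra_simps sum.distrib)

lemma koszul_empty: "koszul n a f {} = (\<Sum>j<n. a j * f {j})"
  by (simp add: koszul_def)

lemma koszul_Suc_notin:
  assumes "n \<notin> T"
  shows "koszul (Suc n) a f T = koszul n a f T + (-1) ^ card {i\<in>T. i < n} * a n * f (insert n T)"
proof -
  have "{..<Suc n} - T = insert n ({..<n} - T)" using assms by auto
  then show ?thesis unfolding koszul_def by (simp add: add.commute)
qed

lemma koszul_Suc_insert:
  assumes "n \<notin> T"
  shows "koszul (Suc n) a f (insert n T) = koszul n a (\<lambda>U. f (insert n U)) T"
proof -
  have "{..<Suc n} - insert n T = {..<n} - T" using assms by auto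
  moreover have "{i \<in> insert n T. i < j} = {i \<in> T. i < j}" if "j < n" for j using that by auto
  ultimately show ?thesis unfolding koszul_def by (auto intro!: sum.cong simp: insert_commute)
qed

lemma koszul_Suc_ext_power:
  assumes "f \<in> ext_power n m"
  shows "koszul (Suc n) a f = koszul n a f"
proof
  fix T
  show "koszul (Suc n) a f T = koszul n a f T"
  proof (cases "n \<in> T")
    case False
    have "f (insert n T) = 0" using assms by (auto intro: ext_powerD)
    then show ?thesis using koszul_Suc_notin[OF False, of a f] by simp
  next
    case True
    then have "{..<Suc n} - T = {..<n} - T" by (auto simp: less_Suc_eq)
    then show ?thesis by (simp add: koszul_def)
  qed
qed

lemma koszul_koszul: "koszul n a (koszul n a f) T = 0"
proof (induction n arbitrary: f T)
  case 0
  then show ?case by (simp add: koszul_def)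
next
  case (Suc n)
  show ?case
  proof (cases "n \<in> T")
    case False
    let ?s = "\<lambda>T. (-1) ^ card {i\<in>T. i < n} :: 'a"
    have s: "?s (insert j T) = - ?s T" if "j < n" "j \<notin> T" for j
    proof -
      have "{i \<in> insert j T. i < n} = insert j {i \<in> T. i < n}" using that by auto
      then show ?thesis using that by simp
    qed
    have "koszul n a (koszul (Suc n) a f) T =
        koszul n a (\<lambda>U. koszul n a f U + (- ?s T * a n) * f (insert n U)) T"
    proof (rule koszul_cong)
      fix j assume "j < n" "j \<notin> T"
      then show "koszul (Suc n) a f (insert j T) =
          koszul n a f (insert j T) + (- ?s T * a n) * f (insert n (insert j T))"
        using False s by (subst koszul_Suc_notin) auto
    qed
    also have "\<dots> = - ?s T * a n * koszul n a (\<lambda>U. f (insert n U)) T"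
      by (simp only: koszul_add koszul_mult Suc.IH) simp
    finally show ?thesis
      using False by (simp add: koszul_Suc_notin koszul_Suc_insert)
  next
    case True
    then obtain T' where T: "T = insert n T'" "n \<notin> T'" by (meson mk_disjoint_insert)
    have "koszul (Suc n) a (koszul (Suc n) a f) T = koszul n a (koszul n a (\<lambda>U. f (insert n U))) T'"
      unfolding T(1) koszul_Suc_insert[OF T(2)]
      by (rule koszul_cong) (use T(2) in \<open>auto simp: koszul_Suc_insert\<close>)
    then show ?thesis using Suc.IH by simp
  qed
qed

text \<open>Polarise: the differential of the sequence \<open>a + b\<close> is the sum of those of \<open>a\<close> and \<open>b\<close>, and all
  three square to \<open>0\<close>.\<close>

lemma koszul_anticommute: "koszul n a (koszul n b f) T = - koszul n b (koszul n a f) T"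
proof -
  have "koszul n (\<lambda>j. a j + b j) (koszul n (\<lambda>j. a j + b j) f) T = 0"
    by (rule koszul_koszul)
  then have "koszul n a (koszul n b f) T + koszul n b (koszul n a f) T = 0"
    by (simp add: koszul_coeff_add koszul_add koszul_koszul)
  then show ?thesis by (rule eq_neg_iff_add_eq_0[THEN iffD2])
qed

text \<open>The element \<open>y \<and> e\<^sub>n\<close> of \<open>\<Lambda>\<^sup>m\<^sup>+\<^sup>1 R\<^sup>n\<^sup>+\<^sup>1\<close> for \<open>y \<in> \<Lambda>\<^sup>m R\<^sup>n\<close>.\<close>

definition wedge_last :: "nat \<Rightarrow> (nat set \<Rightarrow> 'a::comm_ring_1) \<Rightarrow> nat set \<Rightarrow> 'a" where
  "wedge_last n y T = (if n \<in> T then y (T - {n}) else 0)"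

lemma wedge_last_in_ext_power:
  assumes "y \<in> ext_power n m"
  shows "wedge_last n y \<in> ext_power (Suc n) (Suc m)"
proof (rule ext_powerI)
  fix T assume "wedge_last n y T \<noteq> 0"
  then have T: "n \<in> T" "y (T - {n}) \<noteq> 0" by (auto simp: wedge_last_def split: if_splits)
  then have *: "T - {n} \<subseteq> {..<n}" "card (T - {n}) = m"
    using assms by (auto simp: ext_power_def)
  then have "finite T" using finite_subset[of "T - {n}" "{..<n}"] by auto
  with * T show "T \<subseteq> {..<Suc n} \<and> card T = Suc m"
    by (metis card_Suc_Diff1 lessThan_Suc subset_insert_iff)
qed

lemma koszul_wedge_last_insert:
  "n \<notin> T \<Longrightarrow> koszul (Suc n) a (wedge_last n y) (insert n T) = koszul n a y T"
  by (auto simp: koszul_Suc_insert wedge_last_def intro!: koszul_cong)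

lemma koszul_koszul_wedge_last_insert:
  assumes "n \<notin> T"
  shows "koszul (Suc n) a (koszul (Suc n) b (wedge_last n y)) (insert n T) = koszul n a (koszul n b y) T"
  unfolding koszul_Suc_insert[OF assms]
  by (rule koszul_cong) (use assms in \<open>auto simp: koszul_wedge_last_insert\<close>)

text \<open>The coordinates of \<open>f\<close> at the sets that contain the last index, as an element \<open>f\<^sub>1\<close> of
  \<open>\<Lambda>\<^sup>m R\<^sup>n\<close>: every \<open>f\<close> is \<open>f\<^sub>0 + f\<^sub>1 \<and> e\<^sub>n\<close> with \<open>f\<^sub>0 \<in> \<Lambda>\<^sup>m\<^sup>+\<^sup>1 R\<^sup>n\<close>.\<close>

definition last_part :: "nat \<Rightarrow> (nat set \<Rightarrow> 'a::comm_ring_1) \<Rightarrow> nat set \<Rightarrow> 'a" where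
  "last_part n f T = (if n \<in> T then 0 else f (insert n T))"

lemma last_part_in_ext_power:
  assumes "f \<in> ext_power (Suc n) (Suc m)"
  shows "last_part n f \<in> ext_power n m"
proof (rule ext_powerI)
  fix T assume "last_part n f T \<noteq> 0"
  then have T: "n \<notin> T" "f (insert n T) \<noteq> 0" by (auto simp: last_part_def split: if_splits)
  then have *: "insert n T \<subseteq> {..<Suc n}" "card (insert n T) = Suc m"
    using assms by (auto simp: ext_power_def)
  then have "finite T" using finite_subset[of "insert n T" "{..<Suc n}"] by auto
  with * T show "T \<subseteq> {..<n} \<and> card T = m" by (auto simp: less_Suc_eq)
qed

lemma koszul_last_part:
  assumes f: "f \<in> ext_power (Suc n) (Suc m)" and 0: "koszul (Suc n) a f = (\<lambda>T. 0)"
  shows "koszul n a (last_part n f) = (\<lambda>T. 0)"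
proof
  fix T
  show "koszul n a (last_part n f) T = 0"
  proof (cases "n \<in> T")
    case True
    then show ?thesis by (simp add: koszul_def last_part_def)
  next
    case False
    then have "koszul n a (last_part n f) T = koszul n a (\<lambda>U. f (insert n U)) T"
      by (intro koszul_cong) (auto simp: last_part_def)
    also have "\<dots> = koszul (Suc n) a f (insert n T)" using False by (simp add: koszul_Suc_insert)
    finally show ?thesis using 0 by simp
  qed
qed

lemma ext_power_restrict:
  assumes "f \<in> ext_power (Suc n) m" "\<And>T. n \<notin> T \<Longrightarrow> f (insert n T) = 0"
  shows "f \<in> ext_power n m"
proof (rule ext_powerI)
  fix T assume T: "f T \<noteq> 0"
  have "n \<notin> T" using assms(2)[of "T - {n}"] T by (metis Diff_iff insertI1 insert_Diff)
  then show "T \<subseteq> {..<n} \<and> card T = m" using assms(1) T by (auto simp: ext_power_def lessThan_Suc)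
qed

lemma koszul_Suc_empty_eq_0:
  assumes "koszul (Suc n) a f = (\<lambda>T. 0)"
  shows "a n * f {n} = (\<Sum>j<n. a j * - f {j})"
proof -
  have "koszul (Suc n) a f {} = 0" using assms by simp
  then show ?thesis by (simp add: koszul_empty sum_negf add_eq_0_iff)
qed

lemma ext_power_0_eqI:
  assumes "f \<in> ext_power n 0" "g \<in> ext_power n 0" "f {} = g {}"
  shows "f = g"
proof
  fix T
  have "T = {} \<or> (f T = 0 \<and> g T = 0)"
    using assms(1,2) unfolding ext_power_def
    by (metis (mono_tags, lifting) card_eq_0_iff finite_lessThan finite_subset mem_Collect_eq)
  then show "f T = g T" using assms(3) by auto
qed

lemma last_part_empty: "last_part n f {} = f {n}"
  by (simp add: last_part_def)

text \<open>Writing a cycle as \<open>f\<^sub>0 + f\<^sub>1 \<and> e\<^sub>n\<close>, its part \<open>f\<^sub>1\<close> is a cycle for the shorter sequence, hence a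
  boundary \<open>\<partial> y\<close>; for \<open>f\<^sub>1\<close> of degree \<open>0\<close> this is the regularity of the sequence. Subtracting
  \<open>\<partial> (y \<and> e\<^sub>n)\<close> reduces to \<open>f\<^sub>1 = 0\<close>.\<close>

lemma koszul_exact:
  fixes a :: "nat \<Rightarrow> 'a::comm_ring_1"
  assumes "\<And>k x c. k < n \<Longrightarrow> a k * x = (\<Sum>j<k. a j * c j) \<Longrightarrow> \<exists>c'. x = (\<Sum>j<k. a j * c' j)"
    and "f \<in> ext_power n (Suc m)" and "koszul n a f = (\<lambda>T. 0)"
  shows "\<exists>g \<in> ext_power n (Suc (Suc m)). koszul n a g = f"
  using assms
proof (induction n arbitrary: f m)
  case 0
  then have "f = (\<lambda>T. 0)" by (intro ext) (auto intro: ext_powerD)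
  then show ?case by (intro bexI[of _ "\<lambda>T. 0"]) (simp_all add: ext_power_zero)
next
  case (Suc n)
  have IH: "\<exists>g \<in> ext_power n (Suc (Suc m)). koszul n a g = f"
    if "f \<in> ext_power n (Suc m)" "koszul n a f = (\<lambda>T. 0)" for f m
    by (rule Suc.IH[OF _ that]) (rule Suc.prems(1)[OF less_SucI])
  have f1: "last_part n f \<in> ext_power n m" by (rule last_part_in_ext_power) fact
  have K1: "koszul n a (last_part n f) = (\<lambda>T. 0)" by (rule koszul_last_part) fact+
  have "\<exists>y \<in> ext_power n (Suc m). koszul n a y = last_part n f"
  proof (cases m)
    case 0
    obtain c where c: "f {n} = (\<Sum>j<n. a j * c j)"
      using Suc.prems(1)[OF lessI koszul_Suc_empty_eq_0[OF Suc.prems(3)]] by blast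
    define y where "y T = (if \<exists>j<n. T = {j} then c (THE j. T = {j}) else 0)" for T
    have y: "y \<in> ext_power n (Suc 0)" by (auto simp: ext_power_def y_def)
    have "koszul n a y {} = f {n}" by (simp add: koszul_empty c y_def)
    then have "koszul n a y = last_part n f"
      using f1 0 koszul_in_ext_power[OF y, of a] by (intro ext_power_0_eqI) (auto simp: last_part_empty)
    then show ?thesis using y 0 by auto
  next
    case (Suc m')
    then show ?thesis using IH f1 K1 by blast
  qed
  then obtain y where y: "y \<in> ext_power n (Suc m)" "koszul n a y = last_part n f" by blast
  let ?Y = "wedge_last n y"
  let ?w = "\<lambda>T. f T - koszul (Suc n) a ?Y T"
  have Y: "?Y \<in> ext_power (Suc n) (Suc (Suc m))" by (rule wedge_last_in_ext_power) fact
  have w: "?w \<in> ext_power n (Suc m)"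
  proof (rule ext_power_restrict)
    show "?w \<in> ext_power (Suc n) (Suc m)"
      by (intro ext_power_diff koszul_in_ext_power Y Suc.prems(2))
    show "?w (insert n T) = 0" if "n \<notin> T" for T
      using that y(2) by (simp add: koszul_wedge_last_insert last_part_def)
  qed
  have "koszul n a ?w = koszul (Suc n) a ?w" using koszul_Suc_ext_power[OF w] by simp
  also have "\<dots> = (\<lambda>T. 0)" using Suc.prems(3) by (simp add: koszul_diff koszul_koszul)
  finally obtain z where z: "z \<in> ext_power n (Suc (Suc m))" "koszul n a z = ?w"
    using IH w by blast
  have "koszul (Suc n) a (\<lambda>T. z T + ?Y T) = f"
    unfolding koszul_add koszul_Suc_ext_power[OF z(1)] z(2) by simp
  then show ?case using ext_power_add[OF ext_power_Suc[OF z(1)] Y] by blast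
qed

text \<open>The same induction for two sequences at once: the part \<open>f\<^sub>1\<close> is again killed by both
  differentials. If it has degree \<open>0\<close>, it is the last coordinate of a common syzygy of the rows \<open>a\<close>
  and \<open>b\<close>, and by hypothesis it lies in the ideal of the \<open>2\<close>-minors of the preceding columns.\<close>

lemma koszul_double_exact:
  fixes a b :: "nat \<Rightarrow> 'a::comm_ring_1"
  assumes "\<And>k x w. k < n \<Longrightarrow> a k * x = (\<Sum>j<k. a j * w j) \<Longrightarrow> b k * x = (\<Sum>j<k. b j * w j) \<Longrightarrow>
      \<exists>y \<in> ext_power k 2. koszul k a (koszul k b y) {} = x"
    and "f \<in> ext_power n (Suc m)" and "koszul n a f = (\<lambda>T. 0)" and "koszul n b f = (\<lambda>T. 0)"
  shows "\<exists>g \<in> ext_power n (m + 3). koszul n a (koszul n b g) = f"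
  using assms
proof (induction n arbitrary: f m)
  case 0
  then have "f = (\<lambda>T. 0)" by (intro ext) (auto intro: ext_powerD)
  then show ?case by (intro bexI[of _ "\<lambda>T. 0"]) (simp_all add: ext_power_zero)
next
  case (Suc n)
  have IH: "\<exists>g \<in> ext_power n (m + 3). koszul n a (koszul n b g) = f"
    if "f \<in> ext_power n (Suc m)" "koszul n a f = (\<lambda>T. 0)" "koszul n b f = (\<lambda>T. 0)" for f m
    by (rule Suc.IH[OF _ that]) (rule Suc.prems(1)[OF less_SucI])
  have f1: "last_part n f \<in> ext_power n m" by (rule last_part_in_ext_power) fact
  have K1: "koszul n a (last_part n f) = (\<lambda>T. 0)" "koszul n b (last_part n f) = (\<lambda>T. 0)"
    by (rule koszul_last_part, fact+)+
  have "\<exists>y \<in> ext_power n (m + 2). koszul n a (koszul n b y) = last_part n f"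
  proof (cases m)
    case 0
    obtain y where y: "y \<in> ext_power n 2" "koszul n a (koszul n b y) {} = f {n}"
      using Suc.prems(1)[OF lessI koszul_Suc_empty_eq_0[OF Suc.prems(3)]
          koszul_Suc_empty_eq_0[OF Suc.prems(4)]] by blast
    have "koszul n a (koszul n b y) \<in> ext_power n 0"
      using y(1) by (intro koszul_in_ext_power) (simp add: numeral_2_eq_2)
    then have "koszul n a (koszul n b y) = last_part n f"
      using f1 0 y by (intro ext_power_0_eqI) (auto simp: last_part_empty)
    then show ?thesis using y 0 by (auto simp: numeral_2_eq_2)
  next
    case (Suc m')
    then show ?thesis using IH[of "last_part n f" m'] f1 K1 by (simp add: numeral_3_eq_3)
  qed
  then obtain y where y: "y \<in> ext_power n (m + 2)" "koszul n a (koszul n b y) = last_part n f" by blast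
  let ?Y = "wedge_last n y"
  let ?w = "\<lambda>T. f T - koszul (Suc n) a (koszul (Suc n) b ?Y) T"
  have Y: "?Y \<in> ext_power (Suc n) (m + 3)"
    using wedge_last_in_ext_power[OF y(1)] by (simp add: numeral_3_eq_3)
  have w: "?w \<in> ext_power n (Suc m)"
  proof (rule ext_power_restrict)
    show "?w \<in> ext_power (Suc n) (Suc m)"
      using Y by (intro ext_power_diff koszul_in_ext_power Suc.prems(2)) (simp add: numeral_3_eq_3)
    show "?w (insert n T) = 0" if "n \<notin> T" for T
      using that y(2) by (simp add: koszul_koszul_wedge_last_insert last_part_def)
  qed
  have "koszul n a ?w = koszul (Suc n) a ?w" using koszul_Suc_ext_power[OF w] by simp
  also have "\<dots> = (\<lambda>T. 0)" using Suc.prems(3) by (simp add: koszul_diff koszul_koszul)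
  finally have wa: "koszul n a ?w = (\<lambda>T. 0)" .
  have "koszul n b ?w = koszul (Suc n) b ?w" using koszul_Suc_ext_power[OF w] by simp
  also have "\<dots> = (\<lambda>T. - koszul (Suc n) b (koszul (Suc n) a (koszul (Suc n) b ?Y)) T)"
    using Suc.prems(4) by (simp add: koszul_diff)
  also have "\<dots> = (\<lambda>T. koszul (Suc n) a (koszul (Suc n) b (koszul (Suc n) b ?Y)) T)"
    using koszul_anticommute[of "Suc n" a b] by simp
  also have "\<dots> = (\<lambda>T. 0)"
    using koszul_koszul[of "Suc n" b ?Y] by (subst ext[of "koszul (Suc n) b (koszul (Suc n) b ?Y)" "\<lambda>T. 0"]) auto
  finally obtain z where z: "z \<in> ext_power n (m + 3)" "koszul n a (koszul n b z) = ?w"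
    using IH[OF w wa] by blast
  have "koszul n b z \<in> ext_power n (m + 2)"
    using z(1) by (intro koszul_in_ext_power) (simp add: numeral_3_eq_3)
  then have "koszul (Suc n) a (koszul (Suc n) b (\<lambda>T. z T + ?Y T)) = f"
    unfolding koszul_add koszul_Suc_ext_power[OF z(1)] by (simp add: koszul_Suc_ext_power z(2))
  then show ?case using ext_power_add[OF ext_power_Suc[OF z(1)] Y] by blast
qed


section \<open>The Eagon--Northcott complex as a total complex\<close>

text \<open>The Eagon--Northcott complex of the matrix with rows \<open>a\<close>, \<open>b\<close> has the modules
  \<open>(\<Lambda>\<^sup>i\<^sup>+\<^sup>2 R\<^sup>n)\<^sup>i\<^sup>+\<^sup>1\<close>, and its differential sends \<open>(f\<^sub>0, \<dots>, f\<^sub>i)\<close> to the family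
  \<open>\<partial>\<^sub>a f\<^sub>q + \<partial>\<^sub>b f\<^sub>q\<^sub>+\<^sub>1\<close> with \<open>q < i\<close>. It is the total complex of a double complex built from
  \<open>\<partial>\<^sub>a\<close> and \<open>\<partial>\<^sub>b\<close>. The last component of a cycle satisfies \<open>\<partial>\<^sub>a \<partial>\<^sub>b f\<^sub>i = 0\<close>, so that
  \<open>\<partial>\<^sub>b f\<^sub>i = \<partial>\<^sub>b \<partial>\<^sub>a g\<^sub>i\<close> by the exactness of the pair; then \<open>f\<^sub>i - \<partial>\<^sub>a g\<^sub>i\<close> is a \<open>\<partial>\<^sub>b\<close>-cycle, and the
  other components follow by descending along rows that are exact for \<open>\<partial>\<^sub>a\<close>.\<close>

lemma total_complex_exact:
  fixes a b :: "nat \<Rightarrow> 'a::comm_ring_1"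
  assumes Ka: "\<And>f m. f \<in> ext_power n (Suc m) \<Longrightarrow> koszul n a f = (\<lambda>T. 0) \<Longrightarrow>
      \<exists>g \<in> ext_power n (Suc (Suc m)). koszul n a g = f"
    and Kb: "\<And>f m. f \<in> ext_power n (Suc m) \<Longrightarrow> koszul n b f = (\<lambda>T. 0) \<Longrightarrow>
      \<exists>g \<in> ext_power n (Suc (Suc m)). koszul n b g = f"
    and Kab: "\<And>f m. f \<in> ext_power n (Suc m) \<Longrightarrow> koszul n a f = (\<lambda>T. 0) \<Longrightarrow> koszul n b f = (\<lambda>T. 0) \<Longrightarrow>
      \<exists>g \<in> ext_power n (m + 3). koszul n a (koszul n b g) = f"
    and f: "\<And>q. q \<le> i \<Longrightarrow> f q \<in> ext_power n (i + 2)"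
    and cyc: "\<And>q T. q < i \<Longrightarrow> koszul n a (f q) T + koszul n b (f (Suc q)) T = 0"
    and aug: "i = 0 \<Longrightarrow> koszul n a (koszul n b (f 0)) = (\<lambda>T. 0)"
  shows "\<exists>g. (\<forall>q \<le> Suc i. g q \<in> ext_power n (i + 3)) \<and>
             (\<forall>q \<le> i. \<forall>T. f q T = koszul n a (g q) T + koszul n b (g (Suc q)) T)"
proof -
  have top: "koszul n a (koszul n b (f i)) = (\<lambda>T. 0)"
  proof (cases i)
    case (Suc i')
    have "koszul n b (f i) = (\<lambda>T. - koszul n a (f i') T)"
      using cyc[of i'] Suc by (auto simp: add_eq_0_iff intro!: ext)
    then show ?thesis by (simp add: koszul_uminus koszul_koszul)
  qed (use aug in simp)
  have "\<exists>g. (\<forall>q. i - k \<le> q \<and> q \<le> Suc i \<longrightarrow> g q \<in> ext_power n (i + 3)) \<and>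
          (\<forall>q. i - k \<le> q \<and> q \<le> i \<longrightarrow> (\<forall>T. f q T = koszul n a (g q) T + koszul n b (g (Suc q)) T))"
    if "k \<le> i" for k
    using that
  proof (induction k)
    case 0
    have bb: "koszul n b (koszul n b (f i)) = (\<lambda>T. 0)"
      by (rule ext) (rule koszul_koszul)
    have "koszul n b (f i) \<in> ext_power n (Suc i)"
      using f by (intro koszul_in_ext_power) simp
    then obtain y where y: "y \<in> ext_power n (i + 3)" "koszul n a (koszul n b y) = koszul n b (f i)"
      using Kab[OF _ top bb] by blast
    \<comment> \<open>the sign makes up for \<open>\<partial>\<^sub>a \<partial>\<^sub>b = - \<partial>\<^sub>b \<partial>\<^sub>a\<close>\<close>
    let ?y = "\<lambda>T. - y T"
    let ?w = "\<lambda>T. f i T - koszul n a ?y T"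
    have y': "?y \<in> ext_power n (i + 3)" using ext_power_mult[OF y(1), of "-1"] by simp
    have "?w \<in> ext_power n (Suc (Suc i))"
      using y' f by (intro ext_power_diff koszul_in_ext_power) (simp_all add: numeral_3_eq_3)
    moreover have "koszul n b ?w = (\<lambda>T. 0)"
      using y(2) koszul_anticommute[of n a b y]
      by (auto simp: koszul_diff koszul_add koszul_uminus intro!: ext)
    ultimately obtain z where z: "z \<in> ext_power n (i + 3)" "koszul n b z = ?w"
      using Kb[of ?w "Suc i"] by (auto simp: numeral_3_eq_3)
    show ?case
      by (intro exI[of _ "\<lambda>q. if q = i then ?y else z"]) (use z y' in \<open>auto simp: le_Suc_eq\<close>)
  next
    case (Suc k)
    then obtain g where g: "\<And>q. i - k \<le> q \<Longrightarrow> q \<le> Suc i \<Longrightarrow> g q \<in> ext_power n (i + 3)"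
      "\<And>q T. i - k \<le> q \<Longrightarrow> q \<le> i \<Longrightarrow> f q T = koszul n a (g q) T + koszul n b (g (Suc q)) T"
      by auto
    define q where "q = i - Suc k"
    have q: "Suc q = i - k" "q < i" using Suc.prems by (auto simp: q_def)
    let ?w = "\<lambda>T. f q T - koszul n b (g (Suc q)) T"
    have gq: "g (Suc q) \<in> ext_power n (i + 3)" using g(1)[of "Suc q"] q by auto
    have "?w \<in> ext_power n (Suc (Suc i))"
      using gq f[of q] q by (intro ext_power_diff koszul_in_ext_power) (simp_all add: numeral_3_eq_3)
    moreover have "koszul n a ?w = (\<lambda>T. 0)"
    proof
      fix T
      have "koszul n b (f (Suc q)) T = koszul n b (koszul n a (g (Suc q))) T"
        using g(2)[of "Suc q"] q
        by (subst ext[of "f (Suc q)" "\<lambda>T. koszul n a (g (Suc q)) T + koszul n b (g (Suc (Suc q))) T"])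
           (auto simp: koszul_add koszul_koszul)
      then show "koszul n a ?w T = 0"
        using cyc[OF q(2), of T] by (simp add: koszul_diff koszul_anticommute[of n a b])
    qed
    ultimately obtain z where z: "z \<in> ext_power n (i + 3)" "koszul n a z = ?w"
      using Ka[of ?w "Suc i"] by (auto simp: numeral_3_eq_3)
    have *: "i - Suc k \<le> q' \<longleftrightarrow> q' = q \<or> i - k \<le> q'" for q' using q unfolding q_def by linarith
    show ?case
      by (intro exI[of _ "g(q := z)"]) (use z g q in \<open>auto simp: *\<close>)
  qed
  from this[of i] show ?thesis by auto
qed


section \<open>Monomials in polynomial rings\<close>

abbreviation lookup where "lookup \<equiv> Poly_Mapping.lookup"
abbreviation keys where "keys \<equiv> Poly_Mapping.keys"
abbreviation monomial where "monomial \<equiv> Poly_Mapping.single"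

lemma sum_monomials: "(\<Sum>m\<in>keys p. monomial m (lookup p m)) = p"
  by (rule poly_mapping_eqI)
     (auto simp: lookup_sum lookup_single when_def sum.delta in_keys_iff)

lemma times_sum_monomials:
  "p * q = (\<Sum>m\<in>keys p. \<Sum>m'\<in>keys q. monomial (m + m') (lookup p m * lookup q m'))"
proof -
  have "p * q = (\<Sum>m\<in>keys p. monomial m (lookup p m)) * (\<Sum>m\<in>keys q. monomial m (lookup q m))"
    by (simp add: sum_monomials)
  then show ?thesis by (simp add: sum_product mult_single)
qed

lemma lookup_monomial_times:
  fixes t :: "'v \<Rightarrow>\<^sub>0 nat"
  shows "lookup (monomial t c * p) (t + m) = c * lookup p m"
proof -
  have "monomial t c * p = (\<Sum>m'\<in>keys p. monomial (t + m') (c * lookup p m'))"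
    using arg_cong[OF sum_monomials[of p], of "(*) (monomial t c)"]
    by (simp add: sum_distrib_left mult_single)
  then show ?thesis by (auto simp: lookup_sum lookup_single when_def sum.delta in_keys_iff)
qed

lemma keys_monomial_times:
  "s \<in> keys (monomial t c * p) \<Longrightarrow> \<exists>m \<in> keys p. s = t + m"
  using keys_mult[of "monomial t c" p] by (auto split: if_splits)

lemma keys_add_exponents: "keys (m + m') = keys m \<union> keys (m' :: 'v \<Rightarrow>\<^sub>0 nat)"
  by (auto simp: in_keys_iff lookup_add)

lemma exponent_minus_add:
  fixes t m :: "'v \<Rightarrow>\<^sub>0 nat"
  assumes "\<And>v. lookup t v \<le> lookup m v"
  shows "t + (m - t) = m"
  by (rule poly_mapping_eqI) (use assms in \<open>simp add: lookup_add lookup_minus\<close>)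

text \<open>A sequence of pairwise coprime monomials is regular: if \<open>A k + m\<close> is a multiple of \<open>A j\<close>,
  then so is \<open>m\<close>.\<close>

lemma coprime_monomials_regular:
  fixes A :: "nat \<Rightarrow> 'v \<Rightarrow>\<^sub>0 nat" and x :: "('v, 'k::comm_ring_1) mpoly"
  assumes disj: "\<And>j. j < k \<Longrightarrow> keys (A j) \<inter> keys (A k) = {}"
    and eq: "monomial (A k) 1 * x = (\<Sum>j<k. monomial (A j) 1 * c j)"
  shows "\<exists>c'. x = (\<Sum>j<k. monomial (A j) 1 * c' j)"
proof -
  have "\<exists>j<k. \<forall>v. lookup (A j) v \<le> lookup m v" if m: "m \<in> keys x" for m
  proof -
    have "A k + m \<in> keys (\<Sum>j<k. monomial (A j) 1 * c j)"
      using m by (simp add: eq[symmetric] in_keys_iff lookup_monomial_times)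
    then obtain j where j: "j < k" "A k + m \<in> keys (monomial (A j) 1 * c j)"
      using keys_sum[of "\<lambda>j. monomial (A j) 1 * c j" "{..<k}"] by auto
    then obtain m' where m': "A k + m = A j + m'" using keys_monomial_times by blast
    have "lookup (A j) v \<le> lookup m v" for v
    proof (cases "v \<in> keys (A j)")
      case True
      then have "lookup (A k) v = 0" using disj[OF j(1)] by (auto simp: in_keys_iff)
      then show ?thesis using arg_cong[OF m', of "\<lambda>t. lookup t v"] by (simp add: lookup_add)
    qed (simp add: in_keys_iff)
    then show ?thesis using j(1) by blast
  qed
  then obtain J where J: "\<And>m. m \<in> keys x \<Longrightarrow> J m < k"
      "\<And>m v. m \<in> keys x \<Longrightarrow> lookup (A (J m)) v \<le> lookup m v"
    by metis
  have "(\<Sum>j<k. monomial (A j) 1 * (\<Sum>m | m \<in> keys x \<and> J m = j. monomial (m - A j) (lookup x m)))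
      = (\<Sum>j<k. \<Sum>m | m \<in> keys x \<and> J m = j. monomial m (lookup x m))"
    by (intro sum.cong refl)
       (auto simp: sum_distrib_left mult_single J exponent_minus_add intro!: sum.cong)
  also have "\<dots> = (\<Sum>m\<in>keys x. monomial m (lookup x m))"
    by (rule sum.group) (use J in auto)
  finally show ?thesis
    unfolding sum_monomials
    by (intro exI[of _ "\<lambda>j. \<Sum>m | m \<in> keys x \<and> J m = j. monomial (m - A j) (lookup x m)"]) simp
qed


section \<open>Minors of a matrix of coprime monomials\<close>

text \<open>The congruence of exponents modulo the lattice spanned by the differences
  \<open>(A\<^sub>i - B\<^sub>i) - (A\<^sub>j - B\<^sub>j)\<close>, \<open>i, j < k\<close>.\<close>

definition lattice_cong ::
  "(nat \<Rightarrow> 'v \<Rightarrow>\<^sub>0 nat) \<Rightarrow> (nat \<Rightarrow> 'v \<Rightarrow>\<^sub>0 nat) \<Rightarrow> nat \<Rightarrow> ('v \<Rightarrow>\<^sub>0 nat) \<Rightarrow> ('v \<Rightarrow>\<^sub>0 nat) \<Rightarrow> bool" where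
  "lattice_cong A B k m m' \<longleftrightarrow> (\<exists>t :: nat \<Rightarrow> int. (\<Sum>j<k. t j) = 0 \<and>
     (\<forall>v. int (lookup m' v) =
            int (lookup m v) + (\<Sum>j<k. t j * (int (lookup (A j) v) - int (lookup (B j) v)))))"

lemma lattice_cong_refl: "lattice_cong A B k m m"
  unfolding lattice_cong_def by (intro exI[of _ "\<lambda>_. 0"]) simp

lemma lattice_cong_sym: "lattice_cong A B k m m' \<Longrightarrow> lattice_cong A B k m' m"
  unfolding lattice_cong_def
proof (elim exE conjE)
  fix t :: "nat \<Rightarrow> int"
  assume "(\<Sum>j<k. t j) = 0" "\<forall>v. int (lookup m' v) =
            int (lookup m v) + (\<Sum>j<k. t j * (int (lookup (A j) v) - int (lookup (B j) v)))"
  then show "\<exists>t :: nat \<Rightarrow> int. (\<Sum>j<k. t j) = 0 \<and> (\<forall>v. int (lookup m v) =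
            int (lookup m' v) + (\<Sum>j<k. t j * (int (lookup (A j) v) - int (lookup (B j) v))))"
    by (intro exI[of _ "\<lambda>j. - t j"]) (simp add: sum_negf)
qed

lemma lattice_cong_trans:
  "lattice_cong A B k m m' \<Longrightarrow> lattice_cong A B k m' m'' \<Longrightarrow> lattice_cong A B k m m''"
  unfolding lattice_cong_def
proof (elim exE conjE)
  fix t u :: "nat \<Rightarrow> int"
  assume "(\<Sum>j<k. t j) = 0" "\<forall>v. int (lookup m' v) =
            int (lookup m v) + (\<Sum>j<k. t j * (int (lookup (A j) v) - int (lookup (B j) v)))"
    "(\<Sum>j<k. u j) = 0" "\<forall>v. int (lookup m'' v) =
            int (lookup m' v) + (\<Sum>j<k. u j * (int (lookup (A j) v) - int (lookup (B j) v)))"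
  then show "\<exists>t :: nat \<Rightarrow> int. (\<Sum>j<k. t j) = 0 \<and> (\<forall>v. int (lookup m'' v) =
            int (lookup m v) + (\<Sum>j<k. t j * (int (lookup (A j) v) - int (lookup (B j) v))))"
    by (intro exI[of _ "\<lambda>j. t j + u j"]) (simp add: sum.distrib distrib_right)
qed

lemma lattice_cong_add_left: "lattice_cong A B k (c + m) (c + m') \<longleftrightarrow> lattice_cong A B k m m'"
  unfolding lattice_cong_def by (simp add: lookup_add)

lemma lattice_cong_class:
  assumes "lattice_cong A B k m m'"
  shows "lattice_cong A B k m = lattice_cong A B k m'"
  using assms lattice_cong_sym lattice_cong_trans by blast

lemma sum_indicator_times:
  "i < k \<Longrightarrow> (\<Sum>l<k. (if l = i then 1 else 0) * f l) = (f i :: 'a::semiring_1)" for i k :: nat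
  by (subst sum.mono_neutral_right[of _ "{i}"]) auto

lemma lattice_cong_exchange:
  assumes "i < k" "j < k"
  shows "lattice_cong A B k (A i + B j) (A j + B i)"
  unfolding lattice_cong_def
proof (intro exI conjI allI)
  let ?t = "\<lambda>l. (if l = j then 1 else 0) - (if l = i then 1 else 0) :: int"
  show "(\<Sum>l<k. ?t l) = 0" using assms by (simp add: sum_subtractf)
  show "int (lookup (A j + B i) v) = int (lookup (A i + B j) v) +
      (\<Sum>l<k. ?t l * (int (lookup (A l) v) - int (lookup (B l) v)))" for v
    using assms by (simp only: left_diff_distrib sum_subtractf sum_indicator_times) (simp add: lookup_add)
qed

definition class_sum :: "('m \<Rightarrow> bool) \<Rightarrow> ('m \<Rightarrow>\<^sub>0 'k::comm_ring_1) \<Rightarrow> 'k" where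
  "class_sum C p = (\<Sum>m | m \<in> keys p \<and> C m. lookup p m)"

lemma class_sum_superset:
  assumes "finite S" "keys p \<subseteq> S"
  shows "class_sum C p = (\<Sum>m | m \<in> S \<and> C m. lookup p m)"
  unfolding class_sum_def by (rule sum.mono_neutral_left) (use assms in \<open>auto simp: in_keys_iff\<close>)

lemma class_sum_add: "class_sum C (p + q) = class_sum C p + class_sum C q"
proof -
  have "class_sum C r = (\<Sum>m | m \<in> keys p \<union> keys q \<and> C m. lookup r m)"
    if "r \<in> {p + q, p, q}" for r
    by (rule class_sum_superset) (use that keys_add[of p q] in auto)
  then show ?thesis by (simp add: lookup_add sum.distrib)
qed

lemma class_sum_uminus: "class_sum C (- p) = - class_sum C p"
  by (simp add: class_sum_def sum_negf)

lemma class_sum_diff: "class_sum C (p - q) = class_sum C p - class_sum C q"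
  using class_sum_add[of C p "- q"] by (simp add: class_sum_uminus)

lemma class_sum_zero: "class_sum C 0 = 0"
  by (simp add: class_sum_def)

lemma class_sum_monomial: "class_sum C (monomial m c) = (if C m then c else 0)"
proof -
  have "class_sum C (monomial m c) = (\<Sum>m' | m' \<in> {m} \<and> C m'. lookup (monomial m c) m')"
    by (rule class_sum_superset) auto
  also have "{m'. m' \<in> {m} \<and> C m'} = (if C m then {m} else {})" by auto
  finally show ?thesis by auto
qed

lemma class_sum_monomial_times:
  fixes t :: "'v \<Rightarrow>\<^sub>0 nat"
  shows "class_sum C (monomial t c * p) = c * class_sum (\<lambda>m. C (t + m)) p"
proof -
  have "class_sum C (monomial t c * p) = (\<Sum>m | m \<in> (+) t ` keys p \<and> C m. lookup (monomial t c * p) m)"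
    by (rule class_sum_superset) (simp, use keys_monomial_times in blast)
  also have "{m. m \<in> (+) t ` keys p \<and> C m} = (+) t ` {m \<in> keys p. C (t + m)}" by auto
  also have "(\<Sum>m\<in>(+) t ` {m \<in> keys p. C (t + m)}. lookup (monomial t c * p) m) =
      (\<Sum>m | m \<in> keys p \<and> C (t + m). c * lookup p m)"
    by (subst sum.reindex) (auto simp: lookup_monomial_times)
  finally show ?thesis by (simp add: class_sum_def sum_distrib_left)
qed

lemma class_sum_nonzeroD:
  assumes "class_sum C p \<noteq> 0"
  shows "\<exists>m \<in> keys p. C m"
proof (rule ccontr)
  assume "\<not> ?thesis"
  then have "{m. m \<in> keys p \<and> C m} = {}" by blast
  then show False using assms unfolding class_sum_def by (metis sum.empty)
qed

definition lattice_ideal ::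
  "(nat \<Rightarrow> 'v \<Rightarrow>\<^sub>0 nat) \<Rightarrow> (nat \<Rightarrow> 'v \<Rightarrow>\<^sub>0 nat) \<Rightarrow> nat \<Rightarrow> ('v, 'k::comm_ring_1) mpoly set" where
  "lattice_ideal A B k = {p. \<forall>m. class_sum (lattice_cong A B k m) p = 0}"

lemma lattice_ideal_zero: "0 \<in> lattice_ideal A B k"
  by (simp add: lattice_ideal_def class_sum_zero)

lemma lattice_ideal_add:
  "p \<in> lattice_ideal A B k \<Longrightarrow> q \<in> lattice_ideal A B k \<Longrightarrow> p + q \<in> lattice_ideal A B k"
  by (simp add: lattice_ideal_def class_sum_add)

lemma lattice_ideal_sum:
  "(\<And>i. i \<in> I \<Longrightarrow> p i \<in> lattice_ideal A B k) \<Longrightarrow> (\<Sum>i\<in>I. p i) \<in> lattice_ideal A B k"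
  by (induction I rule: infinite_finite_induct) (auto intro: lattice_ideal_zero lattice_ideal_add)

lemma lattice_ideal_monomial_times:
  assumes "p \<in> lattice_ideal A B k"
  shows "monomial t c * p \<in> lattice_ideal A B k"
  unfolding lattice_ideal_def
proof (intro CollectI allI)
  fix m
  show "class_sum (lattice_cong A B k m) (monomial t c * p) = 0"
  proof (cases "\<exists>m'. lattice_cong A B k m (t + m')")
    case True
    then obtain m' where "lattice_cong A B k m = lattice_cong A B k (t + m')"
      using lattice_cong_class by blast
    then show ?thesis using assms
      by (simp add: class_sum_monomial_times lattice_cong_add_left lattice_ideal_def)
  next
    case False
    then have "class_sum (\<lambda>m'. lattice_cong A B k m (t + m')) p = 0" by (simp add: class_sum_def)
    then show ?thesis by (simp add: class_sum_monomial_times)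
  qed
qed

lemma lattice_ideal_times:
  assumes "p \<in> lattice_ideal A B k"
  shows "q * p \<in> lattice_ideal A B k"
  by (subst sum_monomials[of q, symmetric], subst sum_distrib_right)
     (intro lattice_ideal_sum lattice_ideal_monomial_times assms)

lemma minor_in_lattice_ideal:
  assumes "i < k" "j < k"
  shows "monomial (A i) 1 * monomial (B j) 1 - monomial (A j) 1 * monomial (B i) 1 \<in> lattice_ideal A B k"
proof -
  have "lattice_cong A B k m (A i + B j) \<longleftrightarrow> lattice_cong A B k m (A j + B i)" for m
    using lattice_cong_class[OF lattice_cong_exchange[OF assms]] lattice_cong_sym by metis
  then show ?thesis
    by (simp add: lattice_ideal_def class_sum_diff class_sum_monomial mult_single)
qed

text \<open>A binomial \<open>x\<^sup>s - x\<^sup>t\<close> whose exponents differ at a variable that the lattice does not involve is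
  a nonzerodivisor modulo the lattice ideal: consider a residue class with nonzero coefficient sum
  in which the exponent of this variable is maximal.\<close>

lemma lattice_ideal_nonzerodivisor:
  fixes x :: "('v, 'k::comm_ring_1) mpoly"
  assumes v: "\<And>j. j < k \<Longrightarrow> v \<notin> keys (A j) \<and> v \<notin> keys (B j)"
    and st: "lookup t v < lookup s v"
    and x: "(monomial s 1 - monomial t 1) * x \<in> lattice_ideal A B k"
  shows "x \<in> lattice_ideal A B k"
proof (rule ccontr)
  assume "x \<notin> lattice_ideal A B k"
  define S where "S = {m \<in> keys x. class_sum (lattice_cong A B k m) x \<noteq> 0}"
  have in_S: "\<exists>m' \<in> S. lattice_cong A B k m m'" if nz: "class_sum (lattice_cong A B k m) x \<noteq> 0" for m
  proof -
    obtain m' where m': "m' \<in> keys x" "lattice_cong A B k m m'"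
      using class_sum_nonzeroD[OF nz] by blast
    have "m' \<in> S" using nz m'(1) unfolding S_def lattice_cong_class[OF m'(2)] by blast
    then show ?thesis using m'(2) by blast
  qed
  have "S \<noteq> {}" using \<open>x \<notin> _\<close> in_S by (auto simp: lattice_ideal_def)
  moreover have "finite S" by (simp add: S_def)
  ultimately have "Max ((\<lambda>m. lookup m v) ` S) \<in> (\<lambda>m. lookup m v) ` S" by simp
  then obtain m where "m \<in> S" "lookup m v = Max ((\<lambda>m. lookup m v) ` S)" by auto
  then have m: "m \<in> S" "\<And>m'. m' \<in> S \<Longrightarrow> lookup m' v \<le> lookup m v"
    using \<open>finite S\<close> by auto
  have "0 = class_sum (lattice_cong A B k (s + m)) ((monomial s 1 - monomial t 1) * x)"
    using x by (simp add: lattice_ideal_def)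
  also have "\<dots> = class_sum (lattice_cong A B k m) x - class_sum (\<lambda>m'. lattice_cong A B k (s + m) (t + m')) x"
    by (simp add: left_diff_distrib class_sum_diff class_sum_monomial_times lattice_cong_add_left)
  finally have nz: "class_sum (\<lambda>m'. lattice_cong A B k (s + m) (t + m')) x \<noteq> 0"
    using m(1) by (auto simp: S_def)
  then obtain m' where m': "lattice_cong A B k (s + m) (t + m')"
    using class_sum_nonzeroD by blast
  have "lattice_cong A B k (s + m) (t + m'') \<longleftrightarrow> lattice_cong A B k m' m''" for m''
    using lattice_cong_class[OF m'] by (simp add: lattice_cong_add_left)
  with nz have "class_sum (lattice_cong A B k m') x \<noteq> 0" by simp
  with in_S obtain m'' where m'': "m'' \<in> S" "lattice_cong A B k m' m''" by blast
  then have "lattice_cong A B k (s + m) (t + m'')"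
    using lattice_cong_class[OF m'] by (simp add: lattice_cong_add_left)
  then obtain c :: "nat \<Rightarrow> int" where "int (lookup (t + m'') v) = int (lookup (s + m) v) +
       (\<Sum>j<k. c j * (int (lookup (A j) v) - int (lookup (B j) v)))"
    unfolding lattice_cong_def by blast
  moreover have "(\<Sum>j<k. c j * (int (lookup (A j) v) - int (lookup (B j) v))) = 0"
    using v by (intro sum.neutral) (auto simp: in_keys_iff)
  ultimately have "lookup m v < lookup m'' v" using st by (simp add: lookup_add)
  then show False using m(2)[OF m''(1)] by simp
qed

text \<open>By \<open>koszul_koszul_empty\<close> these are the combinations of the \<open>2\<close>-minors of the first \<open>k\<close> columns.\<close>

definition minors_ideal :: "(nat \<Rightarrow> 'a::comm_ring_1) \<Rightarrow> (nat \<Rightarrow> 'a) \<Rightarrow> nat \<Rightarrow> 'a set" where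
  "minors_ideal a b k = {koszul k a (koszul k b y) {} | y. y \<in> ext_power k 2}"

lemma koszul_koszul_empty:
  "koszul k a (koszul k b y) {} = (\<Sum>l<k. \<Sum>j<l. (a l * b j - a j * b l) * y {j, l})"
proof (induction k)
  case 0
  then show ?case by (simp add: koszul_def)
next
  case (Suc k)
  have "koszul (Suc k) a (koszul (Suc k) b y) {} =
      koszul k a (koszul (Suc k) b y) {} + a k * koszul k b (\<lambda>U. y (insert k U)) {}"
    by (simp add: koszul_Suc_notin koszul_Suc_insert)
  also have "koszul k a (koszul (Suc k) b y) {} = koszul k a (\<lambda>U. koszul k b y U + - b k * y (insert k U)) {}"
  proof (rule koszul_cong)
    fix j assume "j < k"
    then have "{i \<in> {j}. i < k} = {j}" by auto
    then show "koszul (Suc k) b y (insert j {}) = koszul k b y (insert j {}) + - b k * y (insert k (insert j {}))"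
      using \<open>j < k\<close> by (subst koszul_Suc_notin) auto
  qed
  also have "\<dots> = koszul k a (koszul k b y) {} - b k * koszul k a (\<lambda>U. y (insert k U)) {}"
    by (simp only: koszul_add koszul_mult) simp
  finally have "koszul (Suc k) a (koszul (Suc k) b y) {} =
      (\<Sum>l<k. \<Sum>j<l. (a l * b j - a j * b l) * y {j, l}) -
      b k * (\<Sum>j<k. a j * y {k, j}) + a k * (\<Sum>j<k. b j * y {k, j})"
    unfolding Suc.IH koszul_empty[of k _ "\<lambda>U. y (insert k U)"] .
  moreover have "(\<Sum>j<k. (a k * b j - a j * b k) * y {j, k}) =
      a k * (\<Sum>j<k. b j * y {k, j}) - b k * (\<Sum>j<k. a j * y {k, j})"
    unfolding sum_distrib_left sum_subtractf[symmetric]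
    by (intro sum.cong refl) (simp add: algebra_simps insert_commute)
  ultimately show ?case by simp
qed

lemma minors_ideal_zero: "0 \<in> minors_ideal a b k"
  unfolding minors_ideal_def by (intro CollectI exI[of _ "\<lambda>T. 0"]) (simp add: ext_power_zero)

lemma minors_ideal_add: "p \<in> minors_ideal a b k \<Longrightarrow> q \<in> minors_ideal a b k \<Longrightarrow> p + q \<in> minors_ideal a b k"
  unfolding minors_ideal_def
proof (elim CollectE exE conjE)
  fix y z assume "y \<in> ext_power k 2" "z \<in> ext_power k 2"
    "p = koszul k a (koszul k b y) {}" "q = koszul k a (koszul k b z) {}"
  then show "p + q \<in> {koszul k a (koszul k b y) {} |y. y \<in> ext_power k 2}"
    by (intro CollectI exI[of _ "\<lambda>T. y T + z T"]) (simp add: ext_power_add koszul_add)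
qed

lemma minors_ideal_times: "p \<in> minors_ideal a b k \<Longrightarrow> c * p \<in> minors_ideal a b k"
  unfolding minors_ideal_def
proof (elim CollectE exE conjE)
  fix y assume "y \<in> ext_power k 2" "p = koszul k a (koszul k b y) {}"
  then show "c * p \<in> {koszul k a (koszul k b y) {} |y. y \<in> ext_power k 2}"
    by (intro CollectI exI[of _ "\<lambda>T. c * y T"]) (simp add: ext_power_mult koszul_mult)
qed

lemma minors_ideal_uminus: "p \<in> minors_ideal a b k \<Longrightarrow> - p \<in> minors_ideal a b k"
  using minors_ideal_times[of p a b k "-1"] by simp

lemma minors_ideal_sum:
  "(\<And>i. i \<in> I \<Longrightarrow> p i \<in> minors_ideal a b k) \<Longrightarrow> (\<Sum>i\<in>I. p i) \<in> minors_ideal a b k"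
  by (induction I rule: infinite_finite_induct) (auto intro: minors_ideal_zero minors_ideal_add)

lemma minor_in_minors_ideal:
  assumes "i < k" "j < k"
  shows "a i * b j - a j * b i \<in> minors_ideal a b k"
proof -
  have less: "a i * b j - a j * b i \<in> minors_ideal a b k" if "j < i" "i < k" for i j
  proof -
    let ?y = "\<lambda>T. if T = {j, i} then 1 else 0 :: 'a"
    have eq: "{j', l'} = {j, i} \<longleftrightarrow> j' = j \<and> l' = i" if "j' < l'" for j' l'
      using that \<open>j < i\<close> by (auto simp: doubleton_eq_iff)
    have "koszul k a (koszul k b ?y) {} =
        (\<Sum>l'<k. \<Sum>j'<l'. if l' = i then if j' = j then a i * b j - a j * b i else 0 else 0)"
      unfolding koszul_koszul_empty by (intro sum.cong refl) (auto simp: eq)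
    also have "\<dots> = (\<Sum>l'<k. if l' = i then a i * b j - a j * b i else 0)"
      using that by (intro sum.cong refl) auto
    also have "\<dots> = a i * b j - a j * b i" using that by simp
    finally have "koszul k a (koszul k b ?y) {} = a i * b j - a j * b i" .
    moreover have "?y \<in> ext_power k 2"
      using that by (auto simp: ext_power_def)
    ultimately show ?thesis unfolding minors_ideal_def by (intro CollectI exI[of _ ?y]) simp
  qed
  consider "j < i" | "i = j" | "i < j" by linarith
  then show ?thesis
  proof cases
    case 3
    then have "- (a j * b i - a i * b j) \<in> minors_ideal a b k"
      using less assms by (intro minors_ideal_uminus) auto
    then show ?thesis by simp
  qed (use less assms in \<open>auto simp: minors_ideal_zero\<close>)
qed

text \<open>The type argument names the coefficient ring, which the exponents do not determine.\<close>

locale coprime_columns =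
  fixes A B :: "nat \<Rightarrow> 'v \<Rightarrow>\<^sub>0 nat" and n :: nat and k_type :: "'k::comm_ring_1 itself"
  assumes disj_A: "\<And>i j. i < n \<Longrightarrow> j < n \<Longrightarrow> i \<noteq> j \<Longrightarrow> keys (A i) \<inter> keys (A j) = {}"
    and disj_B: "\<And>i j. i < n \<Longrightarrow> j < n \<Longrightarrow> i \<noteq> j \<Longrightarrow> keys (B i) \<inter> keys (B j) = {}"
    and disj_AB: "\<And>i j. i < n \<Longrightarrow> j < n \<Longrightarrow> keys (A i) \<inter> keys (B j) = {}"
    and A_nonzero: "\<And>j. j < n \<Longrightarrow> A j \<noteq> 0"
    and B_nonzero: "\<And>j. j < n \<Longrightarrow> B j \<noteq> 0"
begin

definition row_a :: "nat \<Rightarrow> ('v, 'k) mpoly" where "row_a j = monomial (A j) 1"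
definition row_b :: "nat \<Rightarrow> ('v, 'k) mpoly" where "row_b j = monomial (B j) 1"

text \<open>If the exponents \<open>m\<close> and \<open>m'\<close> differ by \<open>\<Sum>\<^sub>j t\<^sub>j (A\<^sub>j - B\<^sub>j)\<close>, choose \<open>i\<close>, \<open>j\<close> with \<open>t\<^sub>i < 0 < t\<^sub>j\<close>.
  Since \<open>m'\<close> is nonnegative and the supports are disjoint, \<open>A\<^sub>i + B\<^sub>j\<close> divides \<open>m\<close>; replacing it by
  \<open>A\<^sub>j + B\<^sub>i\<close> changes the monomial by a multiple of a minor and moves \<open>m\<close> closer to \<open>m'\<close>.\<close>

lemma lattice_binomial_in_minors_ideal:
  assumes k: "k \<le> n" and t: "(\<Sum>j<k. t j) = 0"
    and m': "\<And>v. int (lookup m' v) =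
            int (lookup m v) + (\<Sum>j<k. t j * (int (lookup (A j) v) - int (lookup (B j) v)))"
  shows "monomial m 1 - monomial m' 1 \<in> minors_ideal row_a row_b k"
  using t m'
proof (induction "nat (\<Sum>j<k. \<bar>t j\<bar>)" arbitrary: t m rule: less_induct)
  case less
  let ?D = "\<lambda>t v. \<Sum>l<k. t l * (int (lookup (A l) v) - int (lookup (B l) v))"
  show ?case
  proof (cases "\<forall>j<k. t j = 0")
    case True
    then have "m' = m" using less.prems(2) by (intro poly_mapping_eqI) simp
    then show ?thesis by (simp add: minors_ideal_zero)
  next
    case False
    have "\<exists>i<k. t i < 0"
    proof (rule ccontr)
      assume "\<not> ?thesis"
      then have "\<And>l. l \<in> {..<k} \<Longrightarrow> 0 \<le> t l" by force
      then have "\<forall>j\<in>{..<k}. t j = 0"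
        using less.prems(1) sum_nonneg_eq_0_iff[of "{..<k}" t] by blast
      then show False using False by simp
    qed
    then obtain i where i: "i < k" "t i < 0" by blast
    have "\<exists>j<k. t j > 0"
    proof (rule ccontr)
      assume "\<not> ?thesis"
      then have "\<And>l. l \<in> {..<k} \<Longrightarrow> 0 \<le> - t l" by force
      then have "\<forall>j\<in>{..<k}. - t j = 0"
        using less.prems(1) sum_nonneg_eq_0_iff[of "{..<k}" "\<lambda>l. - t l"] by (simp add: sum_negf)
      then show False using False by simp
    qed
    then obtain j where j: "j < k" "t j > 0" by blast
    have ij: "i \<noteq> j" "i < n" "j < n" using i j k by auto
    have divides: "lookup (A i + B j) v \<le> lookup m v" for v
    proof -
      consider (A) "v \<in> keys (A i)" | (B) "v \<in> keys (B j)" | (none) "v \<notin> keys (A i)" "v \<notin> keys (B j)" by blast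
      then show ?thesis
      proof cases
        case A
        have 0: "lookup (B l) v = 0" if "l < n" for l
          using A disj_AB[OF ij(2) that] by (auto simp: in_keys_iff)
        have "lookup (A l) v = 0" if "l < n" "l \<noteq> i" for l
          using A disj_A[OF that(1) ij(2)] that by (auto simp: in_keys_iff)
        then have "?D t v = (\<Sum>l\<in>{i}. t l * (int (lookup (A l) v) - int (lookup (B l) v)))"
          using i k 0 by (intro sum.mono_neutral_right) auto
        then have "?D t v = t i * int (lookup (A i) v)" using 0 ij by simp
        then have "0 \<le> int (lookup m v) + t i * int (lookup (A i) v)"
          using less.prems(2)[of v] of_nat_0_le_iff[of "lookup m' v"] by linarith
        moreover have "t i * int (lookup (A i) v) \<le> (-1) * int (lookup (A i) v)"
          using i by (intro mult_right_mono) auto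
        ultimately show ?thesis using 0 ij by (simp add: lookup_add)
      next
        case B
        have 0: "lookup (A l) v = 0" if "l < n" for l
          using B disj_AB[OF that ij(3)] by (auto simp: in_keys_iff)
        have "lookup (B l) v = 0" if "l < n" "l \<noteq> j" for l
          using B disj_B[OF that(1) ij(3)] that by (auto simp: in_keys_iff)
        then have "?D t v = (\<Sum>l\<in>{j}. t l * (int (lookup (A l) v) - int (lookup (B l) v)))"
          using j k 0 by (intro sum.mono_neutral_right) auto
        then have "?D t v = - (t j * int (lookup (B j) v))" using 0 ij by simp
        then have "0 \<le> int (lookup m v) - t j * int (lookup (B j) v)"
          using less.prems(2)[of v] of_nat_0_le_iff[of "lookup m' v"] by linarith
        moreover have "1 * int (lookup (B j) v) \<le> t j * int (lookup (B j) v)"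
          using j by (intro mult_right_mono) auto
        ultimately show ?thesis using 0 ij by (simp add: lookup_add)
      qed (simp add: lookup_add in_keys_iff)
    qed
    define c where "c = m - (A i + B j)"
    have m: "m = A i + B j + c" using exponent_minus_add[OF divides] by (simp add: c_def)
    define s where "s l = t l + (if l = i then 1 else 0) - (if l = j then 1 else 0)" for l
    let ?m = "A j + B i + c"
    have "\<bar>s l\<bar> \<le> \<bar>t l\<bar>" for l using i j by (auto simp: s_def)
    moreover have "\<bar>s i\<bar> < \<bar>t i\<bar>" using i ij by (auto simp: s_def)
    ultimately have "(\<Sum>l<k. \<bar>s l\<bar>) < (\<Sum>l<k. \<bar>t l\<bar>)"
      using i by (intro sum_strict_mono_ex1) (auto intro!: bexI[of _ i])
    then have dec: "nat (\<Sum>l<k. \<bar>s l\<bar>) < nat (\<Sum>l<k. \<bar>t l\<bar>)"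
      by (metis nat_less_eq_zless sum_abs_ge_zero)
    have s0: "(\<Sum>l<k. s l) = 0"
      using i j less.prems(1) by (simp add: s_def sum_subtractf sum.distrib)
    have sm: "int (lookup m' v) = int (lookup ?m v) + ?D s v" for v
    proof -
      have "?D s v = ?D t v + ?D (\<lambda>l. if l = i then 1 else 0) v - ?D (\<lambda>l. if l = j then 1 else 0) v"
        by (simp only: s_def left_diff_distrib distrib_right sum_subtractf sum.distrib)
      also have "?D (\<lambda>l. if l = i then 1 else 0) v = int (lookup (A i) v) - int (lookup (B i) v)"
        by (rule sum_indicator_times[OF i(1)])
      also have "?D (\<lambda>l. if l = j then 1 else 0) v = int (lookup (A j) v) - int (lookup (B j) v)"
        by (rule sum_indicator_times[OF j(1)])
      finally show ?thesis using less.prems(2)[of v] by (simp add: m lookup_add)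
    qed
    have "monomial ?m 1 - monomial m' 1 \<in> minors_ideal row_a row_b k"
      by (rule less.hyps[OF dec s0 sm])
    moreover have "monomial c 1 * (row_a i * row_b j - row_a j * row_b i) \<in> minors_ideal row_a row_b k"
      using i j by (intro minors_ideal_times minor_in_minors_ideal)
    ultimately have "monomial c 1 * (row_a i * row_b j - row_a j * row_b i) + (monomial ?m 1 - monomial m' 1)
        \<in> minors_ideal row_a row_b k"
      by (rule minors_ideal_add[rotated])
    then show ?thesis
      by (simp add: row_a_def row_b_def right_diff_distrib mult_single m add.commute add.left_commute)
  qed
qed

lemma lattice_ideal_eq_minors_ideal:
  assumes k: "k \<le> n"
  shows "lattice_ideal A B k = minors_ideal row_a row_b k"
proof
  show "minors_ideal row_a row_b k \<subseteq> lattice_ideal A B k"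
  proof
    fix p assume "p \<in> minors_ideal row_a row_b k"
    then obtain y where "p = (\<Sum>l<k. \<Sum>j<l. (row_a l * row_b j - row_a j * row_b l) * y {j, l})"
      unfolding minors_ideal_def koszul_koszul_empty by blast
    moreover have "y {j, l} * (row_a l * row_b j - row_a j * row_b l) \<in> lattice_ideal A B k"
      if "l < k" "j < l" for l j
      using that unfolding row_a_def row_b_def
      by (intro lattice_ideal_times minor_in_lattice_ideal) auto
    ultimately show "p \<in> lattice_ideal A B k"
      by (auto intro!: lattice_ideal_sum simp: mult.commute[of "row_a _ * row_b _ - row_a _ * row_b _"])
  qed
next
  show "lattice_ideal A B k \<subseteq> minors_ideal row_a row_b k"
  proof
    fix p :: "('v, 'k) mpoly" assume p: "p \<in> lattice_ideal A B k"
    define rep where "rep m = Eps (lattice_cong A B k m)" for m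
    have rep: "lattice_cong A B k m (rep m)" for m
      unfolding rep_def by (rule someI) (rule lattice_cong_refl)
    have rep_eq: "rep m = rep m' \<longleftrightarrow> lattice_cong A B k m' m" for m m'
    proof
      assume "rep m = rep m'"
      then show "lattice_cong A B k m' m" using rep lattice_cong_sym lattice_cong_trans by metis
    next
      assume "lattice_cong A B k m' m"
      then show "rep m = rep m'" using lattice_cong_class rep_def by metis
    qed
    have diff: "monomial m c - monomial (rep m) c \<in> minors_ideal row_a row_b k" for m c
    proof -
      have "monomial m 1 - monomial (rep m) 1 \<in> minors_ideal row_a row_b k"
        using rep[of m] lattice_binomial_in_minors_ideal[OF k] unfolding lattice_cong_def by blast
      from minors_ideal_times[OF this, of "monomial 0 c"] show ?thesis
        by (simp add: right_diff_distrib mult_single)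
    qed
    have "(\<Sum>m\<in>keys p. monomial (rep m) (lookup p m)) = 0"
    proof (rule poly_mapping_eqI)
      fix r
      have *: "lookup (\<Sum>m\<in>keys p. monomial (rep m) (lookup p m)) r = (\<Sum>m | m \<in> keys p \<and> rep m = r. lookup p m)"
        by (simp add: lookup_sum lookup_single when_def sum.If_cases Int_def conj_commute)
      show "lookup (\<Sum>m\<in>keys p. monomial (rep m) (lookup p m)) r = lookup 0 r"
      proof (cases "\<exists>m'. r = rep m'")
        case True
        then obtain m' where "r = rep m'" by blast
        then show ?thesis using p unfolding * by (simp add: rep_eq lattice_ideal_def class_sum_def)
      next
        case False
        then have "{m. m \<in> keys p \<and> rep m = r} = {}" by auto
        then show ?thesis unfolding * by (simp only: sum.empty lookup_zero)
      qed
    qed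
    then have eq: "p = (\<Sum>m\<in>keys p. monomial m (lookup p m) - monomial (rep m) (lookup p m))"
      by (simp add: sum_subtractf sum_monomials)
    show "p \<in> minors_ideal row_a row_b k"
      by (subst eq) (intro minors_ideal_sum diff)
  qed
qed

text \<open>Cramer's rule turns a common syzygy of the first \<open>k + 1\<close> columns into the statement that its
  last coordinate times the minor of columns \<open>0\<close> and \<open>k\<close> lies in the ideal of the minors of the
  preceding columns, and this minor is a nonzerodivisor modulo that ideal.\<close>

lemma syzygy_coordinate_in_minors_ideal:
  assumes k: "k < n"
    and a: "row_a k * x = (\<Sum>j<k. row_a j * w j)" and b: "row_b k * x = (\<Sum>j<k. row_b j * w j)"
  shows "\<exists>y \<in> ext_power k 2. koszul k row_a (koszul k row_b y) {} = x"
proof -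
  have "x \<in> minors_ideal row_a row_b k"
  proof (cases "k = 0")
    case True
    then have "row_a 0 * x = 0" using a by simp
    then have "lookup x m = 0" for m
      using lookup_monomial_times[of "A 0" 1 x m] by (simp add: row_a_def)
    then have "x = 0" by (intro poly_mapping_eqI) simp
    then show ?thesis by (simp add: minors_ideal_zero)
  next
    case False
    have "(row_b 0 * row_a k - row_a 0 * row_b k) * x = row_b 0 * (row_a k * x) - row_a 0 * (row_b k * x)"
      by (simp add: algebra_simps)
    also have "\<dots> = (\<Sum>j<k. w j * (row_a j * row_b 0 - row_a 0 * row_b j))"
      unfolding a b sum_distrib_left sum_subtractf[symmetric]
      by (intro sum.cong refl) (simp add: algebra_simps)
    also have "\<dots> \<in> minors_ideal row_a row_b k"
      using False by (intro minors_ideal_sum minors_ideal_times minor_in_minors_ideal) auto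
    finally have *: "(monomial (B 0 + A k) 1 - monomial (A 0 + B k) 1) * x \<in> lattice_ideal A B k"
      using k by (simp add: lattice_ideal_eq_minors_ideal row_a_def row_b_def mult_single)
    obtain v where v: "v \<in> keys (A k)" using A_nonzero[OF k] by fastforce
    have v_new: "v \<notin> keys (A j) \<and> v \<notin> keys (B j)" if "j < k" for j
      using v disj_A[of j k] disj_AB[of k j] that k by auto
    have "lookup (A 0) v = 0" "lookup (B k) v = 0" "lookup (A k) v \<noteq> 0"
      using v False k disj_A[of 0 k] disj_AB[of k k]
      by (auto simp flip: not_in_keys_iff_lookup_eq_zero)
    then have less: "lookup (A 0 + B k) v < lookup (B 0 + A k) v" by (simp add: lookup_add)
    have "x \<in> lattice_ideal A B k"
      by (rule lattice_ideal_nonzerodivisor[OF v_new less *])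
    then show ?thesis using k by (simp add: lattice_ideal_eq_minors_ideal)
  qed
  then show ?thesis by (auto simp: minors_ideal_def)
qed

lemma eagon_northcott_exact:
  assumes f: "\<And>q. q \<le> i \<Longrightarrow> f q \<in> ext_power n (i + 2)"
    and cyc: "\<And>q T. q < i \<Longrightarrow> koszul n row_a (f q) T + koszul n row_b (f (Suc q)) T = 0"
    and aug: "i = 0 \<Longrightarrow> koszul n row_a (koszul n row_b (f 0)) = (\<lambda>T. 0)"
  shows "\<exists>g. (\<forall>q \<le> Suc i. g q \<in> ext_power n (i + 3)) \<and>
             (\<forall>q \<le> i. \<forall>T. f q T = koszul n row_a (g q) T + koszul n row_b (g (Suc q)) T)"
proof (rule total_complex_exact[OF _ _ _ f cyc aug])
  have "\<exists>c'. x = (\<Sum>j<k. row_a j * c' j)" if "k < n" "row_a k * x = (\<Sum>j<k. row_a j * c j)" for k x c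
    using that disj_A unfolding row_a_def by (intro coprime_monomials_regular) auto
  then show "\<exists>g \<in> ext_power n (Suc (Suc m)). koszul n row_a g = f"
    if "f \<in> ext_power n (Suc m)" "koszul n row_a f = (\<lambda>T. 0)" for f m
    using that by (intro koszul_exact)
  have "\<exists>c'. x = (\<Sum>j<k. row_b j * c' j)" if "k < n" "row_b k * x = (\<Sum>j<k. row_b j * c j)" for k x c
    using that disj_B unfolding row_b_def by (intro coprime_monomials_regular) auto
  then show "\<exists>g \<in> ext_power n (Suc (Suc m)). koszul n row_b g = f"
    if "f \<in> ext_power n (Suc m)" "koszul n row_b f = (\<lambda>T. 0)" for f m
    using that by (intro koszul_exact)
  show "\<exists>g \<in> ext_power n (m + 3). koszul n row_a (koszul n row_b g) = f"
    if "f \<in> ext_power n (Suc m)" "koszul n row_a f = (\<lambda>T. 0)" "koszul n row_b f = (\<lambda>T. 0)" for f m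
    using that syzygy_coordinate_in_minors_ideal by (intro koszul_double_exact)
qed

end


section \<open>Homogeneous polynomials and graded matrices\<close>

text \<open>The \<open>\<bbbK>\<close>-linear projection onto the monomials that satisfy \<open>P\<close>. With it, a solution of a
  linear system with graded coefficients can be made homogeneous and moved into \<open>\<bbbK>[X]\<close>.\<close>

definition restrict_monomials ::
  "(('v \<Rightarrow>\<^sub>0 nat) \<Rightarrow> bool) \<Rightarrow> ('v, 'k::comm_ring_1) mpoly \<Rightarrow> ('v, 'k) mpoly" where
  "restrict_monomials P p = (\<Sum>m\<in>keys p. if P m then monomial m (lookup p m) else 0)"

lemma lookup_restrict_monomials: "lookup (restrict_monomials P p) m = (if P m then lookup p m else 0)"
proof -
  have "lookup (restrict_monomials P p) m = (\<Sum>m'\<in>keys p. if m' = m then (if P m then lookup p m else 0) else 0)"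
    unfolding restrict_monomials_def lookup_sum
    by (intro sum.cong refl) (auto simp: lookup_single when_def)
  then show ?thesis by (auto simp: in_keys_iff)
qed

lemma restrict_monomials_sum:
  "restrict_monomials P (\<Sum>i\<in>I. p i) = (\<Sum>i\<in>I. restrict_monomials P (p i))"
  by (rule poly_mapping_eqI) (simp add: lookup_restrict_monomials lookup_sum)

lemma restrict_monomials_monomial:
  "restrict_monomials P (monomial m c) = (if P m then monomial m c else 0)"
  by (rule poly_mapping_eqI) (auto simp: lookup_restrict_monomials lookup_single when_def)

lemma restrict_monomials_id: "(\<And>m. m \<in> keys p \<Longrightarrow> P m) \<Longrightarrow> restrict_monomials P p = p"
  by (rule poly_mapping_eqI) (auto simp: lookup_restrict_monomials in_keys_iff)

lemma keys_restrict_monomials: "m \<in> keys (restrict_monomials P p) \<Longrightarrow> P m"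
  by (auto simp: in_keys_iff lookup_restrict_monomials split: if_splits)

lemma restrict_monomials_times:
  assumes "\<And>m m'. m \<in> keys p \<Longrightarrow> P (m + m') \<longleftrightarrow> Q m'"
  shows "restrict_monomials P (p * q) = p * restrict_monomials Q q"
proof -
  have "restrict_monomials P (p * q) =
      (\<Sum>m\<in>keys p. \<Sum>m'\<in>keys q. if Q m' then monomial (m + m') (lookup p m * lookup q m') else 0)"
    using assms by (subst times_sum_monomials)
      (auto simp: restrict_monomials_sum restrict_monomials_monomial intro!: sum.cong)
  also have "\<dots> = (\<Sum>m\<in>keys p. monomial m (lookup p m)) *
      (\<Sum>m'\<in>keys q. if Q m' then monomial m' (lookup q m') else 0)"
    by (auto simp: sum_product mult_single intro!: sum.cong)
  finally show ?thesis by (simp add: sum_monomials restrict_monomials_def)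
qed

definition homogeneous :: "'v set \<Rightarrow> int \<Rightarrow> ('v, 'k::comm_ring_1) mpoly \<Rightarrow> bool" where
  "homogeneous X k p \<longleftrightarrow> (\<forall>m\<in>keys p. keys m \<subseteq> X \<and> int (total_deg m) = k)"

lemma total_deg_superset: "finite S \<Longrightarrow> keys m \<subseteq> S \<Longrightarrow> total_deg m = (\<Sum>x\<in>S. lookup m x)"
  unfolding total_deg_def by (rule sum.mono_neutral_left) (auto simp: in_keys_iff)

lemma total_deg_add: "total_deg (m + m') = total_deg m + total_deg m'"
proof -
  have "total_deg r = (\<Sum>x\<in>keys m \<union> keys m'. lookup r x)" if "r \<in> {m + m', m, m'}" for r
    using that by (intro total_deg_superset) (auto simp: keys_add_exponents)
  then show ?thesis by (simp add: lookup_add sum.distrib)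
qed

lemma total_deg_zero: "total_deg 0 = 0"
  by (simp add: total_deg_def)

lemma homogeneous_zero [simp]: "homogeneous X k 0"
  by (simp add: homogeneous_def)

lemma homogeneous_add: "homogeneous X k p \<Longrightarrow> homogeneous X k q \<Longrightarrow> homogeneous X k (p + q)"
  unfolding homogeneous_def using keys_add[of p q] by blast

lemma homogeneous_uminus: "homogeneous X k p \<Longrightarrow> homogeneous X k (- p)"
  by (simp add: homogeneous_def)

lemma homogeneous_diff: "homogeneous X k p \<Longrightarrow> homogeneous X k q \<Longrightarrow> homogeneous X k (p - q)"
  using homogeneous_add[of X k p "- q"] homogeneous_uminus by fastforce

lemma homogeneous_sum: "(\<And>i. i \<in> I \<Longrightarrow> homogeneous X k (p i)) \<Longrightarrow> homogeneous X k (\<Sum>i\<in>I. p i)"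
  by (induction I rule: infinite_finite_induct) (auto intro: homogeneous_add)

lemma homogeneous_times:
  assumes "homogeneous X k p" "homogeneous X l q"
  shows "homogeneous X (k + l) (p * q)"
  unfolding homogeneous_def
proof
  fix m assume "m \<in> keys (p * q)"
  then obtain m1 m2 where "m1 \<in> keys p" "m2 \<in> keys q" "m = m1 + m2"
    using keys_mult[of p q] by blast
  then show "keys m \<subseteq> X \<and> int (total_deg m) = k + l"
    using assms by (auto simp: homogeneous_def keys_add_exponents total_deg_add)
qed

lemma homogeneous_monomial: "keys m \<subseteq> X \<Longrightarrow> int (total_deg m) = k \<Longrightarrow> homogeneous X k (monomial m c)"
  by (simp add: homogeneous_def)

lemma homogeneous_one: "homogeneous X 0 1"
  by (simp add: homogeneous_def total_deg_zero)

lemma homogeneous_sign: "homogeneous X k p \<Longrightarrow> homogeneous X k ((-1) ^ i * p)"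
  using homogeneous_uminus[of X k p] by (cases "even i") auto

lemma homogeneous_restrict_monomials:
  "homogeneous X k (restrict_monomials (\<lambda>m. keys m \<subseteq> X \<and> int (total_deg m) = k) p)"
  unfolding homogeneous_def using keys_restrict_monomials by blast

lemma poly_ring_restrict_monomials: "restrict_monomials (\<lambda>m. keys m \<subseteq> X) p \<in> poly_ring X"
  unfolding poly_ring_def using keys_restrict_monomials by blast

lemma lookup_zero_times:
  fixes p q :: "('v, 'k::comm_ring_1) mpoly"
  shows "lookup (p * q) 0 = lookup p 0 * lookup q 0"
proof -
  have 0: "m + m' = 0 \<longleftrightarrow> m = 0 \<and> m' = 0" for m m' :: "'v \<Rightarrow>\<^sub>0 nat"
    by (auto simp: poly_mapping_eq_iff lookup_add fun_eq_iff)
  have "lookup (p * q) 0 = (\<Sum>m\<in>keys p. \<Sum>m'\<in>keys q. (lookup p m when m = 0) * (lookup q m' when m' = 0))"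
    by (subst times_sum_monomials) (auto simp: lookup_sum lookup_single when_def 0 intro!: sum.cong)
  also have "\<dots> = (\<Sum>m\<in>keys p. lookup p m when m = 0) * (\<Sum>m\<in>keys q. lookup q m when m = 0)"
    by (simp add: sum_product)
  also have "\<dots> = lookup p 0 * lookup q 0"
    by (simp add: when_def in_keys_iff)
  finally show ?thesis .
qed

lemma homogeneous_lookup_zero: "homogeneous X k p \<Longrightarrow> lookup p 0 \<noteq> 0 \<Longrightarrow> k = 0"
  by (metis homogeneous_def in_keys_iff of_nat_0 total_deg_zero)

lemma graded_map_iff:
  "graded_map X a b A \<longleftrightarrow> A \<in> carrier_mat (length a) (length b) \<and>
     (\<forall>p<length a. \<forall>q<length b. homogeneous X (b ! q - a ! p) (A $$ (p, q)))"
  (is "?l \<longleftrightarrow> ?r")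
proof
  assume l: ?l
  then have A: "A \<in> carrier_mat (length a) (length b)" by (simp add: graded_map_def)
  have "A $$ (p, q) \<in> poly_ring X" if "p < length a" "q < length b" for p q
    using l that elements_matI[OF A that refl] by (auto simp: graded_map_def)
  then show ?r using l by (auto simp: graded_map_def homogeneous_def poly_ring_def)
next
  assume r: ?r
  then show ?l unfolding graded_map_def homogeneous_def poly_ring_def
    by (fastforce dest!: elements_matD)
qed

lemma graded_map_carrier: "graded_map X a b A \<Longrightarrow> A \<in> carrier_mat (length a) (length b)"
  by (simp add: graded_map_def)

lemma graded_map_entry:
  "graded_map X a b A \<Longrightarrow> p < length a \<Longrightarrow> q < length b \<Longrightarrow> homogeneous X (b ! q - a ! p) (A $$ (p, q))"
  by (simp add: graded_map_iff)

lemma index_mult_mat_sum: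
  assumes "A \<in> carrier_mat nr n" "B \<in> carrier_mat n nc" "i < nr" "j < nc"
  shows "(A * B) $$ (i, j) = (\<Sum>r<n. A $$ (i, r) * B $$ (r, j))"
  using assms by (auto simp: scalar_prod_def lessThan_atLeast0 intro!: sum.cong)

lemma index_mult_mat_vec_sum:
  assumes "A \<in> carrier_mat nr n" "v \<in> carrier_vec n" "i < nr"
  shows "(A *\<^sub>v v) $ i = (\<Sum>r<n. A $$ (i, r) * v $ r)"
  using assms by (auto simp: scalar_prod_def lessThan_atLeast0 intro!: sum.cong)

lemma graded_map_mult:
  assumes A: "graded_map X a b A" and B: "graded_map X b c B"
  shows "graded_map X a c (A * B)"
  unfolding graded_map_iff
proof (intro conjI allI impI)
  note carr = graded_map_carrier[OF A] graded_map_carrier[OF B]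
  then show "A * B \<in> carrier_mat (length a) (length c)" by simp
  fix p q assume "p < length a" "q < length c"
  moreover have "homogeneous X (c ! q - a ! p) (A $$ (p, r) * B $$ (r, q))" if "r < length b" for r
    using homogeneous_times[OF graded_map_entry[OF A _ that] graded_map_entry[OF B that]] calculation
    by (simp add: algebra_simps)
  ultimately show "homogeneous X (c ! q - a ! p) ((A * B) $$ (p, q))"
    by (subst index_mult_mat_sum[OF carr]) (auto intro: homogeneous_sum)
qed

lemma graded_map_minus:
  assumes A: "graded_map X a b A" and B: "graded_map X a b B"
  shows "graded_map X a b (A - B)"
  using assms by (auto simp: graded_map_iff intro!: homogeneous_diff)

lemma graded_map_one: "graded_map X a a (1\<^sub>m (length a))"
  by (auto simp: graded_map_iff homogeneous_one)

text \<open>Projections onto sets of monomials commute with a matrix if the monomials of its \<open>(p, q)\<close>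
  entry carry the \<open>q\<close>-th set into the \<open>p\<close>-th one and its complement into the complement.\<close>

lemma mult_mat_vec_restrict_monomials:
  assumes A: "A \<in> carrier_mat nr nc" and w: "w \<in> carrier_vec nc"
    and PQ: "\<And>p q m m'. p < nr \<Longrightarrow> q < nc \<Longrightarrow> m \<in> keys (A $$ (p, q)) \<Longrightarrow> P p (m + m') \<longleftrightarrow> Q q m'"
  shows "A *\<^sub>v vec nc (\<lambda>q. restrict_monomials (Q q) (w $ q)) =
         vec nr (\<lambda>p. restrict_monomials (P p) ((A *\<^sub>v w) $ p))"
proof (rule eq_vecI)
  fix p assume "p < dim_vec (vec nr (\<lambda>p. restrict_monomials (P p) ((A *\<^sub>v w) $ p)))"
  then have p: "p < nr" by simp
  have "(A *\<^sub>v vec nc (\<lambda>q. restrict_monomials (Q q) (w $ q))) $ p =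
      (\<Sum>q<nc. A $$ (p, q) * restrict_monomials (Q q) (w $ q))"
    using index_mult_mat_vec_sum[OF A _ p, of "vec nc (\<lambda>q. restrict_monomials (Q q) (w $ q))"] by simp
  also have "\<dots> = (\<Sum>q<nc. restrict_monomials (P p) (A $$ (p, q) * w $ q))"
    using PQ p by (intro sum.cong refl restrict_monomials_times[symmetric]) auto
  also have "\<dots> = restrict_monomials (P p) ((A *\<^sub>v w) $ p)"
    by (simp only: restrict_monomials_sum index_mult_mat_vec_sum[OF A w p])
  finally show "(A *\<^sub>v vec nc (\<lambda>q. restrict_monomials (Q q) (w $ q))) $ p =
      vec nr (\<lambda>p. restrict_monomials (P p) ((A *\<^sub>v w) $ p)) $ p" using p by simp
qed (use A in auto)

text \<open>Any solutions of the linear systems for the columns of \<open>B\<close> can be combined into a graded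
  matrix: projecting their entries to the prescribed degrees and to \<open>\<bbbK>[X]\<close> does not change the
  product with \<open>A\<close>, because \<open>A\<close> and \<open>B\<close> are graded.\<close>

lemma graded_lift:
  assumes A: "graded_map X a b A" and B: "graded_map X a c B"
    and ex: "\<And>q. q < length c \<Longrightarrow> \<exists>w\<in>carrier_vec (length b). A *\<^sub>v w = col B q"
  shows "\<exists>C. graded_map X b c C \<and> A * C = B"
proof -
  note cA = graded_map_carrier[OF A] and cB = graded_map_carrier[OF B]
  obtain w where w: "\<And>q. q < length c \<Longrightarrow> w q \<in> carrier_vec (length b)"
      "\<And>q. q < length c \<Longrightarrow> A *\<^sub>v w q = col B q"
    using ex by metis
  define H where "H k = (\<lambda>m. keys m \<subseteq> X \<and> int (total_deg m) = k)" for k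
  define u where "u q = vec (length b) (\<lambda>r. restrict_monomials (H (c ! q - b ! r)) (w q $ r))" for q
  define C where "C = mat (length b) (length c) (\<lambda>(r, q). u q $ r)"
  have u: "A *\<^sub>v u q = col B q" if q: "q < length c" for q
  proof -
    have "A *\<^sub>v u q = vec (length a) (\<lambda>p. restrict_monomials (H (c ! q - a ! p)) ((A *\<^sub>v w q) $ p))"
      unfolding u_def
    proof (rule mult_mat_vec_restrict_monomials[OF cA w(1)[OF q]])
      fix p r m m' assume "p < length a" "r < length b" "m \<in> keys (A $$ (p, r))"
      then have "keys m \<subseteq> X" "int (total_deg m) = b ! r - a ! p"
        using graded_map_entry[OF A] by (auto simp: homogeneous_def)
      then show "H (c ! q - a ! p) (m + m') \<longleftrightarrow> H (c ! q - b ! r) m'"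
        by (auto simp: H_def keys_add_exponents total_deg_add)
    qed
    also have "\<dots> = col B q"
    proof (rule eq_vecI)
      fix p assume "p < dim_vec (col B q)"
      then have p: "p < length a" using cB by simp
      then have "homogeneous X (c ! q - a ! p) (B $$ (p, q))" using graded_map_entry[OF B] q by simp
      then show "vec (length a) (\<lambda>p. restrict_monomials (H (c ! q - a ! p)) ((A *\<^sub>v w q) $ p)) $ p = col B q $ p"
        using p q cB by (simp add: w(2)[OF q]) (auto simp: H_def homogeneous_def intro!: restrict_monomials_id)
    qed (use cB in simp)
    finally show ?thesis .
  qed
  have cC: "C \<in> carrier_mat (length b) (length c)" by (simp add: C_def)
  have "graded_map X b c C"
    using cC by (auto simp: graded_map_iff C_def u_def H_def homogeneous_restrict_monomials)
  moreover have "A * C = B"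
  proof (rule mat_col_eqI)
    fix q assume "q < dim_col B"
    then have q: "q < length c" using cB by simp
    have "col C q = u q" using q by (auto simp: C_def u_def)
    then show "col (A * C) q = col B q" using u[OF q] col_mult2[OF cA cC q] by simp
  qed (use cA cB cC in auto)
  ultimately show ?thesis by blast
qed


section \<open>Minimal resolutions have the fewest shifts\<close>

text \<open>The augmentation \<open>F\<^sub>0 \<rightarrow> S\<close> is treated as one more differential, with target \<open>S\<close> in degree \<open>0\<close>.\<close>

definition target_shifts :: "('v, 'k::comm_ring_1) graded_free_seq \<Rightarrow> nat \<Rightarrow> int list" where
  "target_shifts F i = (case i of 0 \<Rightarrow> [0] | Suc j \<Rightarrow> shifts F j)"

lemma target_shifts_simps [simp]: "target_shifts F 0 = [0]" "target_shifts F (Suc i) = shifts F i"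
  by (simp_all add: target_shifts_def)

lemma graded_map_diff:
  "graded_free_resolution X I F \<Longrightarrow> graded_map X (target_shifts F i) (shifts F i) (diff F i)"
  by (cases i) (auto simp: graded_free_resolution_def)

lemma resolution_exact:
  "graded_free_resolution X I F \<Longrightarrow>
    (\<lambda>v. diff F (Suc i) *\<^sub>v v) ` free_module X (length (shifts F (Suc i))) =
    mat_kernel (diff F i) \<inter> free_module X (length (shifts F i))"
  by (simp add: graded_free_resolution_def)

lemma resolution_augmentation:
  "graded_free_resolution X I F \<Longrightarrow>
    (\<lambda>v. diff F 0 *\<^sub>v v) ` free_module X (length (shifts F 0)) = (\<lambda>f. vec 1 (\<lambda>_. f)) ` I"
  by (simp add: graded_free_resolution_def)

lemma col_graded_map_in_free_module:
  assumes "graded_map X a b A" "q < length b"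
  shows "col A q \<in> free_module X (length a)"
  using assms by (fastforce simp: free_module_def graded_map_iff homogeneous_def poly_ring_def elim!: vec_setE)

lemma unit_vec_in_free_module: "unit_vec n q \<in> free_module X n"
  by (auto simp: free_module_def poly_ring_def unit_vec_def elim!: vec_setE split: if_splits)

lemma mult_mat_unit_vec:
  assumes "(A :: 'a::comm_ring_1 mat) \<in> carrier_mat nr nc" "q < nc"
  shows "A *\<^sub>v unit_vec nc q = col A q"
  using assms by (intro eq_vecI) auto

lemma resolution_complex:
  assumes F: "graded_free_resolution X I F"
  shows "diff F i * diff F (Suc i) = 0\<^sub>m (length (target_shifts F i)) (length (shifts F (Suc i)))"
proof (rule mat_col_eqI)
  note c1 = graded_map_carrier[OF graded_map_diff[OF F, of i]]
    and c2 = graded_map_carrier[OF graded_map_diff[OF F, of "Suc i"], simplified]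
  fix q assume "q < dim_col (0\<^sub>m (length (target_shifts F i)) (length (shifts F (Suc i))) :: ('a, 'b) mpoly mat)"
  then have q: "q < length (shifts F (Suc i))" by simp
  have "diff F (Suc i) *\<^sub>v unit_vec (length (shifts F (Suc i))) q
      \<in> (\<lambda>v. diff F (Suc i) *\<^sub>v v) ` free_module X (length (shifts F (Suc i)))"
    by (intro imageI unit_vec_in_free_module)
  then have "diff F (Suc i) *\<^sub>v unit_vec (length (shifts F (Suc i))) q \<in> mat_kernel (diff F i)"
    by (simp only: resolution_exact[OF F] Int_iff)
  then have "diff F i *\<^sub>v col (diff F (Suc i)) q = 0\<^sub>v (length (target_shifts F i))"
    using mat_kernelD[OF c1] mult_mat_unit_vec[OF c2 q] by simp
  then show "col (diff F i * diff F (Suc i)) q = col (0\<^sub>m (length (target_shifts F i)) (length (shifts F (Suc i)))) q"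
    using col_mult2[OF c1 c2 q] q by simp
qed (use graded_map_carrier[OF graded_map_diff[OF F, of i]] graded_map_carrier[OF graded_map_diff[OF F, of "Suc i"]] in auto)

lemma resolution_lift:
  assumes F: "graded_free_resolution X I F" and B: "graded_map X (shifts F i) c B"
    and 0: "diff F i * B = 0\<^sub>m (length (target_shifts F i)) (length c)"
  shows "\<exists>C. graded_map X (shifts F (Suc i)) c C \<and> diff F (Suc i) * C = B"
proof (rule graded_lift[OF _ B])
  show "graded_map X (shifts F i) (shifts F (Suc i)) (diff F (Suc i))"
    using graded_map_diff[OF F, of "Suc i"] by simp
  note c1 = graded_map_carrier[OF graded_map_diff[OF F, of i]] and cB = graded_map_carrier[OF B]
  fix q assume q: "q < length c"
  have "diff F i *\<^sub>v col B q = col (diff F i * B) q" using col_mult2[OF c1 cB q] by simp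
  also have "\<dots> = 0\<^sub>v (length (target_shifts F i))" using q by (simp add: 0)
  finally have "col B q \<in> mat_kernel (diff F i)"
    using cB q by (intro mat_kernelI[OF c1]) auto
  then have "col B q \<in> (\<lambda>v. diff F (Suc i) *\<^sub>v v) ` free_module X (length (shifts F (Suc i)))"
    unfolding resolution_exact[OF F] using col_graded_map_in_free_module[OF B q] by (rule IntI)
  then show "\<exists>w\<in>carrier_vec (length (shifts F (Suc i))). diff F (Suc i) *\<^sub>v w = col B q"
    by (auto simp: free_module_def)
qed

lemma resolution_lift_augmentation:
  assumes F: "graded_free_resolution X I F" and G: "graded_free_resolution X I G"
  shows "\<exists>C. graded_map X (shifts F 0) (shifts G 0) C \<and> diff F 0 * C = diff G 0"
proof (rule graded_lift)
  show gF: "graded_map X [0] (shifts F 0) (diff F 0)" and gG: "graded_map X [0] (shifts G 0) (diff G 0)"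
    using F G by (auto simp: graded_free_resolution_def)
  fix q assume q: "q < length (shifts G 0)"
  have "col (diff G 0) q = diff G 0 *\<^sub>v unit_vec (length (shifts G 0)) q"
    using mult_mat_unit_vec[OF graded_map_carrier[OF gG] q] by simp
  then have "col (diff G 0) q \<in> (\<lambda>v. diff G 0 *\<^sub>v v) ` free_module X (length (shifts G 0))"
    using unit_vec_in_free_module by (rule image_eqI)
  then have "col (diff G 0) q \<in> (\<lambda>v. diff F 0 *\<^sub>v v) ` free_module X (length (shifts F 0))"
    by (simp only: resolution_augmentation[OF F] resolution_augmentation[OF G])
  then show "\<exists>w\<in>carrier_vec (length (shifts F 0)). diff F 0 *\<^sub>v w = col (diff G 0) q"
    by (auto simp: free_module_def)
qed

lemma mult_mat_eq_assoc:
  fixes A :: "'a::comm_ring_1 mat"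
  assumes "A \<in> carrier_mat n m" "B \<in> carrier_mat m k" "C \<in> carrier_mat n l" "E \<in> carrier_mat l k"
    "Y \<in> carrier_mat k p" "A * B = C * E"
  shows "A * (B * Y) = C * (E * Y)"
proof -
  have "A * (B * Y) = A * B * Y" by (rule assoc_mult_mat[symmetric]) fact+
  also have "\<dots> = C * E * Y" by (simp only: assms)
  also have "\<dots> = C * (E * Y)" by (rule assoc_mult_mat) fact+
  finally show ?thesis .
qed

text \<open>If \<open>h\<close> and \<open>Z\<close> form a homotopy from \<open>g f\<close> to the identity in one degree, then what remains
  to be corrected in the next degree is a cycle.\<close>

lemma homotopy_step:
  fixes D E :: "'a::comm_ring_1 mat"
  assumes D: "D \<in> carrier_mat n n'" and E: "E \<in> carrier_mat m m'"
    and f: "f \<in> carrier_mat m n" and g: "g \<in> carrier_mat n m"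
    and f': "f' \<in> carrier_mat m' n'" and g': "g' \<in> carrier_mat n' m'"
    and h: "h \<in> carrier_mat n' n" and Z: "Z \<in> carrier_mat n n"
    and comm: "E * f' = f * D" "D * g' = g * E"
    and eq: "g * f = 1\<^sub>m n + D * h + Z" and ZD: "Z * D = 0\<^sub>m n n'"
  shows "D * (g' * f' - 1\<^sub>m n' - h * D) = 0\<^sub>m n n'"
proof -
  have "D * (g' * f') = g * (E * f')"
    by (rule mult_mat_eq_assoc[OF D g' g E f' comm(2)])
  also have "\<dots> = g * f * D"
    unfolding comm(1) by (rule assoc_mult_mat[OF g f D, symmetric])
  also have "\<dots> = (1\<^sub>m n + D * h + Z) * D" by (simp only: eq)
  also have "\<dots> = (1\<^sub>m n + D * h) * D + Z * D"
    using D h Z by (intro add_mult_distrib_mat[of _ n n]) auto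
  also have "(1\<^sub>m n + D * h) * D = 1\<^sub>m n * D + D * h * D"
    using D h by (intro add_mult_distrib_mat[of _ n n]) auto
  also have "1\<^sub>m n * D = D" using D by simp
  also have "D * h * D = D * (h * D)" by (rule assoc_mult_mat[OF D h D])
  also have "Z * D = 0\<^sub>m n n'" by (rule ZD)
  finally have *: "D * (g' * f') = D + D * (h * D)"
    using D h by simp
  have "D * (g' * f' - 1\<^sub>m n' - h * D) = D * (g' * f' - 1\<^sub>m n') - D * (h * D)"
    using D f' g' h by (intro mult_minus_distrib_mat[of _ n n']) auto
  also have "D * (g' * f' - 1\<^sub>m n') = D * (g' * f') - D * 1\<^sub>m n'"
    using D f' g' by (intro mult_minus_distrib_mat[of _ n n']) auto
  finally have **: "D * (g' * f' - 1\<^sub>m n' - h * D) = D * (g' * f') - D * 1\<^sub>m n' - D * (h * D)" .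
  have K: "D + K - D * 1\<^sub>m n' - K = 0\<^sub>m n n'" if "K \<in> carrier_mat n n'" for K
    using D that by (intro eq_matI) auto
  show ?thesis unfolding ** *
    by (rule K, rule mult_carrier_mat[OF D], rule mult_carrier_mat[OF h D])
qed

text \<open>Chain maps between two resolutions of the same ideal, together with the homotopy \<open>h\<close> from
  \<open>g f\<close> to the identity. The summand \<open>Z\<close> is the composition of the differential with the
  homotopy one step below (\<open>0\<close> at the bottom); by the minimality of \<open>F\<close>, its entries have constant
  term \<open>0\<close>.\<close>

lemma comparison_maps:
  fixes F G :: "('v, 'k::comm_ring_1) graded_free_seq"
  assumes F: "minimal_graded_free_resolution X I F" and G: "graded_free_resolution X I G"
  shows "\<exists>f g h Z P Q.
    graded_map X (shifts G i) (shifts F i) f \<and> graded_map X (shifts F i) (shifts G i) g \<and>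
    graded_map X (shifts F (Suc i)) (shifts F i) h \<and>
    Z \<in> carrier_mat (length (shifts F i)) (length (shifts F i)) \<and>
    P \<in> carrier_mat (length (target_shifts G i)) (length (target_shifts F i)) \<and>
    Q \<in> carrier_mat (length (target_shifts F i)) (length (target_shifts G i)) \<and>
    diff G i * f = P * diff F i \<and> diff F i * g = Q * diff G i \<and>
    g * f = 1\<^sub>m (length (shifts F i)) + diff F (Suc i) * h + Z \<and>
    Z * diff F (Suc i) = 0\<^sub>m (length (shifts F i)) (length (shifts F (Suc i))) \<and>
    (\<forall>p<length (shifts F i). \<forall>q<length (shifts F i). lookup (Z $$ (p, q)) 0 = 0)"
proof (induction i)
  have resF: "graded_free_resolution X I F" using F by (simp add: minimal_graded_free_resolution_def)
  note gF = graded_map_diff[OF resF] and gG = graded_map_diff[OF G]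
  case 0
  let ?n = "length (shifts F 0)"
  obtain f where f: "graded_map X (shifts G 0) (shifts F 0) f" "diff G 0 * f = diff F 0"
    using resolution_lift_augmentation[OF G resF] by blast
  obtain g where g: "graded_map X (shifts F 0) (shifts G 0) g" "diff F 0 * g = diff G 0"
    using resolution_lift_augmentation[OF resF G] by blast
  note carr = graded_map_carrier[OF gF[of 0]] graded_map_carrier[OF gG[of 0]]
    graded_map_carrier[OF f(1)] graded_map_carrier[OF g(1)]
  have W: "graded_map X (shifts F 0) (shifts F 0) (g * f - 1\<^sub>m ?n)"
    by (intro graded_map_minus graded_map_mult[OF g(1) f(1)] graded_map_one)
  have "diff F 0 * (g * f - 1\<^sub>m ?n) = diff F 0 * (g * f) - diff F 0 * 1\<^sub>m ?n"
    using carr by (intro mult_minus_distrib_mat[of _ 1 ?n]) auto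
  also have "diff F 0 * 1\<^sub>m ?n = diff F 0" using carr by simp
  also have "diff F 0 * (g * f) = diff F 0"
    using assoc_mult_mat[OF carr(1) carr(4) carr(3)] f(2) g(2) by simp
  also have "diff F 0 - diff F 0 = 0\<^sub>m 1 ?n" using carr by (intro eq_matI) auto
  finally have "diff F 0 * (g * f - 1\<^sub>m ?n) = 0\<^sub>m (length (target_shifts F 0)) ?n" by simp
  then obtain h where h: "graded_map X (shifts F (Suc 0)) (shifts F 0) h" "diff F (Suc 0) * h = g * f - 1\<^sub>m ?n"
    using resolution_lift[OF resF W] by blast
  have "g * f = 1\<^sub>m ?n + diff F (Suc 0) * h + 0\<^sub>m ?n ?n"
    unfolding h(2) using carr by (intro eq_matI) auto
  then show ?case
    using f g h(1) carr graded_map_carrier[OF gF[of "Suc 0"]]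
    by (intro exI[of _ f] exI[of _ g] exI[of _ h] exI[of _ "0\<^sub>m ?n ?n"] exI[of _ "1\<^sub>m 1"]) simp
next
  have resF: "graded_free_resolution X I F" using F by (simp add: minimal_graded_free_resolution_def)
  note gF = graded_map_diff[OF resF] and gG = graded_map_diff[OF G]
  case (Suc i)
  let ?n = "length (shifts F i)" and ?n' = "length (shifts F (Suc i))"
  obtain f g h Z P Q where
    f: "graded_map X (shifts G i) (shifts F i) f" and g: "graded_map X (shifts F i) (shifts G i) g" and
    h: "graded_map X (shifts F (Suc i)) (shifts F i) h" and
    Z: "Z \<in> carrier_mat ?n ?n" and
    P: "P \<in> carrier_mat (length (target_shifts G i)) (length (target_shifts F i))" and
    Q: "Q \<in> carrier_mat (length (target_shifts F i)) (length (target_shifts G i))" and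
    fP: "diff G i * f = P * diff F i" and gQ: "diff F i * g = Q * diff G i" and
    eq: "g * f = 1\<^sub>m ?n + diff F (Suc i) * h + Z" and
    ZD: "Z * diff F (Suc i) = 0\<^sub>m ?n ?n'"
    using Suc.IH by blast
  have gFS: "graded_map X (shifts F i) (shifts F (Suc i)) (diff F (Suc i))"
    and gGS: "graded_map X (shifts G i) (shifts G (Suc i)) (diff G (Suc i))"
    using gF[of "Suc i"] gG[of "Suc i"] by simp_all
  note carr = graded_map_carrier[OF gF[of i]] graded_map_carrier[OF gG[of i]]
    graded_map_carrier[OF f] graded_map_carrier[OF g] graded_map_carrier[OF h]
    graded_map_carrier[OF gFS] graded_map_carrier[OF gGS] P Q Z
  have "diff G i * (f * diff F (Suc i)) = P * (diff F i * diff F (Suc i))"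
    by (rule mult_mat_eq_assoc[OF carr(2,3) P carr(1) graded_map_carrier[OF gFS] fP])
  also have "\<dots> = 0\<^sub>m (length (target_shifts G i)) ?n'"
    using P by (simp add: resolution_complex[OF resF])
  finally obtain f' where f': "graded_map X (shifts G (Suc i)) (shifts F (Suc i)) f'"
      "diff G (Suc i) * f' = f * diff F (Suc i)"
    using resolution_lift[OF G graded_map_mult[OF f gFS]] by blast
  have "diff F i * (g * diff G (Suc i)) = Q * (diff G i * diff G (Suc i))"
    by (rule mult_mat_eq_assoc[OF carr(1,4) Q carr(2) graded_map_carrier[OF gGS] gQ])
  also have "\<dots> = 0\<^sub>m (length (target_shifts F i)) (length (shifts G (Suc i)))"
    using Q by (simp add: resolution_complex[OF G])
  finally obtain g' where g': "graded_map X (shifts F (Suc i)) (shifts G (Suc i)) g'"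
      "diff F (Suc i) * g' = g * diff G (Suc i)"
    using resolution_lift[OF resF graded_map_mult[OF g gGS]] by blast
  note carr' = carr graded_map_carrier[OF f'(1)] graded_map_carrier[OF g'(1)]
  let ?W = "g' * f' - 1\<^sub>m ?n' - h * diff F (Suc i)"
  have W: "graded_map X (shifts F (Suc i)) (shifts F (Suc i)) ?W"
    by (intro graded_map_minus graded_map_one graded_map_mult[OF g'(1) f'(1)] graded_map_mult[OF h gFS])
  have "diff F (Suc i) * ?W = 0\<^sub>m ?n ?n'"
    by (rule homotopy_step[OF graded_map_carrier[OF gFS] graded_map_carrier[OF gGS]
        graded_map_carrier[OF f] graded_map_carrier[OF g] graded_map_carrier[OF f'(1)]
        graded_map_carrier[OF g'(1)] graded_map_carrier[OF h] Z f'(2) g'(2) eq ZD])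
  then obtain h' where h': "graded_map X (shifts F (Suc (Suc i))) (shifts F (Suc i)) h'"
      "diff F (Suc (Suc i)) * h' = ?W"
    using resolution_lift[OF resF W] by auto
  have gf': "g' * f' = 1\<^sub>m ?n' + diff F (Suc (Suc i)) * h' + h * diff F (Suc i)"
    unfolding h'(2) using carr' by (intro eq_matI) auto
  have Z'D: "h * diff F (Suc i) * diff F (Suc (Suc i)) = 0\<^sub>m ?n' (length (shifts F (Suc (Suc i))))"
  proof -
    have "diff F (Suc (Suc i)) \<in> carrier_mat ?n' (length (shifts F (Suc (Suc i))))"
      using graded_map_carrier[OF gF[of "Suc (Suc i)"]] by simp
    then have "h * diff F (Suc i) * diff F (Suc (Suc i)) = h * (diff F (Suc i) * diff F (Suc (Suc i)))"
      using carr by (intro assoc_mult_mat) auto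
    then show ?thesis
      using resolution_complex[OF resF, of "Suc i"] graded_map_carrier[OF h] by simp
  qed
  have Z'0: "lookup ((h * diff F (Suc i)) $$ (p, q)) 0 = 0" if "p < ?n'" "q < ?n'" for p q
  proof -
    have "lookup (diff F (Suc i) $$ (r, q)) 0 = 0" if "r < ?n" for r
      using F elements_matI[OF graded_map_carrier[OF gFS] that \<open>q < ?n'\<close> refl]
      unfolding minimal_graded_free_resolution_def by blast
    then show ?thesis
      using that by (subst index_mult_mat_sum[OF graded_map_carrier[OF h] graded_map_carrier[OF gFS]])
        (auto simp: lookup_sum lookup_zero_times)
  qed
  have cZ': "h * diff F (Suc i) \<in> carrier_mat ?n' ?n'"
    by (rule mult_carrier_mat[OF graded_map_carrier[OF h] graded_map_carrier[OF gFS]])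
  show ?case
    by (rule exI[of _ f'], rule exI[of _ g'], rule exI[of _ h'], rule exI[of _ "h * diff F (Suc i)"],
        rule exI[of _ f], rule exI[of _ g], unfold target_shifts_simps)
      (intro conjI allI impI f' g' h'(1) cZ' graded_map_carrier[OF f] graded_map_carrier[OF g] gf' Z'D Z'0)
qed

text \<open>Modulo the variables the composition \<open>g f\<close> of the comparison maps is the identity of \<open>F\<^sub>i\<close>, so
  that \<open>f\<close> maps every basis vector to an element that involves a basis vector of \<open>G\<^sub>i\<close> with a
  nonzero constant as coefficient; this basis vector has the same degree.\<close>

theorem shifts_minimal_subset:
  fixes F G :: "('v, 'k::comm_ring_1) graded_free_seq"
  assumes F: "minimal_graded_free_resolution X I F" and G: "graded_free_resolution X I G"
  shows "set (shifts F i) \<subseteq> set (shifts G i)"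
proof
  fix j assume "j \<in> set (shifts F i)"
  then obtain q where q: "q < length (shifts F i)" "shifts F i ! q = j" by (auto simp: in_set_conv_nth)
  let ?n = "length (shifts F i)"
  obtain f g h Z where
    f: "graded_map X (shifts G i) (shifts F i) f" and g: "graded_map X (shifts F i) (shifts G i) g" and
    h: "graded_map X (shifts F (Suc i)) (shifts F i) h" and
    Z: "Z \<in> carrier_mat ?n ?n" and
    eq: "g * f = 1\<^sub>m ?n + diff F (Suc i) * h + Z" and
    Z0: "\<And>p q. p < ?n \<Longrightarrow> q < ?n \<Longrightarrow> lookup (Z $$ (p, q)) 0 = 0"
    using comparison_maps[OF F G, of i] by metis
  have gFS: "graded_map X (shifts F i) (shifts F (Suc i)) (diff F (Suc i))"
    using F graded_map_diff[of X I F "Suc i"] by (simp add: minimal_graded_free_resolution_def)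
  have "lookup (diff F (Suc i) $$ (q, r)) 0 = 0" if "r < length (shifts F (Suc i))" for r
    using F elements_matI[OF graded_map_carrier[OF gFS] q(1) that refl]
    unfolding minimal_graded_free_resolution_def by blast
  then have "lookup ((diff F (Suc i) * h) $$ (q, q)) 0 = 0"
    by (subst index_mult_mat_sum[OF graded_map_carrier[OF gFS] graded_map_carrier[OF h] q(1) q(1)])
      (simp add: lookup_sum lookup_zero_times)
  then have "lookup ((g * f) $$ (q, q)) 0 = 1"
    unfolding eq using q(1) Z Z0 graded_map_carrier[OF gFS] graded_map_carrier[OF h]
    by (simp add: lookup_add)
  moreover have "lookup ((g * f) $$ (q, q)) 0 =
      (\<Sum>r<length (shifts G i). lookup (g $$ (q, r)) 0 * lookup (f $$ (r, q)) 0)"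
    by (subst index_mult_mat_sum[OF graded_map_carrier[OF g] graded_map_carrier[OF f] q(1) q(1)])
      (simp add: lookup_sum lookup_zero_times)
  ultimately have "(\<Sum>r<length (shifts G i). lookup (g $$ (q, r)) 0 * lookup (f $$ (r, q)) 0) \<noteq> 0"
    by simp
  then obtain r where r: "r < length (shifts G i)" "lookup (f $$ (r, q)) 0 \<noteq> 0"
    by (metis (no_types, lifting) lessThan_iff mult_zero_right sum.neutral)
  then have "shifts F i ! q - shifts G i ! r = 0"
    using homogeneous_lookup_zero[OF graded_map_entry[OF f r(1) q(1)]] by simp
  then show "j \<in> set (shifts G i)" using q r by auto
qed


section \<open>Resolutions from exact sequences of operators\<close>

text \<open>A free module with a finite basis \<open>xs\<close> is represented by the functions supported on \<open>xs\<close>, and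
  homomorphisms by linear operators on functions. The following definitions pass to coordinates.\<close>

definition supported_on :: "'b list \<Rightarrow> ('b \<Rightarrow> 'a::comm_ring_1) set" where
  "supported_on xs = {f. \<forall>x. x \<notin> set xs \<longrightarrow> f x = 0}"

definition basis_fun :: "'b \<Rightarrow> 'b \<Rightarrow> 'a::comm_ring_1" where
  "basis_fun x y = (if y = x then 1 else 0)"

definition linear_operator :: "(('b \<Rightarrow> 'a::comm_ring_1) \<Rightarrow> 'b \<Rightarrow> 'a) \<Rightarrow> bool" where
  "linear_operator L \<longleftrightarrow> (\<forall>N c f y. L (\<lambda>x. \<Sum>q<N::nat. c q * f q x) y = (\<Sum>q<N. c q * L (f q) y))"

definition operator_mat ::
  "(('b \<Rightarrow> 'a::comm_ring_1) \<Rightarrow> 'b \<Rightarrow> 'a) \<Rightarrow> 'b list \<Rightarrow> 'b list \<Rightarrow> 'a mat" where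
  "operator_mat L ys xs = mat (length ys) (length xs) (\<lambda>(p, q). L (basis_fun (xs ! q)) (ys ! p))"

definition coords :: "'b list \<Rightarrow> ('b \<Rightarrow> 'a::comm_ring_1) \<Rightarrow> 'a vec" where
  "coords xs f = vec (length xs) (\<lambda>p. f (xs ! p))"

definition from_coords :: "'b list \<Rightarrow> 'a::comm_ring_1 vec \<Rightarrow> 'b \<Rightarrow> 'a" where
  "from_coords xs v x = (\<Sum>q<length xs. v $ q * basis_fun (xs ! q) x)"

lemma operator_mat_carrier [simp]: "operator_mat L ys xs \<in> carrier_mat (length ys) (length xs)"
  by (simp add: operator_mat_def)

lemma coords_carrier [simp]: "coords xs f \<in> carrier_vec (length xs)"
  by (simp add: coords_def)

lemma from_coords_supported: "from_coords xs v \<in> supported_on xs"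
  unfolding supported_on_def from_coords_def basis_fun_def by (auto intro!: sum.neutral)

lemma from_coords_nth:
  assumes "distinct xs" "q < length xs"
  shows "from_coords xs v (xs ! q) = v $ q"
proof -
  have "from_coords xs v (xs ! q) = (\<Sum>r<length xs. if r = q then v $ q else 0)"
    unfolding from_coords_def basis_fun_def
    by (intro sum.cong refl) (use assms in \<open>auto simp: nth_eq_iff_index_eq\<close>)
  then show ?thesis using assms by simp
qed

lemma coords_from_coords:
  "distinct xs \<Longrightarrow> v \<in> carrier_vec (length xs) \<Longrightarrow> coords xs (from_coords xs v) = v"
  by (intro eq_vecI) (auto simp: coords_def from_coords_nth)

lemma from_coords_coords:
  assumes "distinct xs" "f \<in> supported_on xs"
  shows "from_coords xs (coords xs f) = f"
proof
  fix x
  show "from_coords xs (coords xs f) x = f x"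
  proof (cases "x \<in> set xs")
    case True
    then show ?thesis using assms(1) by (auto simp: in_set_conv_nth from_coords_nth coords_def)
  next
    case False
    then show ?thesis
      using assms(2) from_coords_supported[of xs "coords xs f"] unfolding supported_on_def by auto
  qed
qed

lemma operator_mat_mult_vec:
  assumes "linear_operator L" "v \<in> carrier_vec (length xs)"
  shows "operator_mat L ys xs *\<^sub>v v = coords ys (L (from_coords xs v))"
proof (rule eq_vecI)
  fix p assume "p < dim_vec (coords ys (L (from_coords xs v)))"
  then have p: "p < length ys" by (simp add: coords_def)
  have "(operator_mat L ys xs *\<^sub>v v) $ p = (\<Sum>q<length xs. v $ q * L (basis_fun (xs ! q)) (ys ! p))"
    using p by (subst index_mult_mat_vec_sum[OF operator_mat_carrier assms(2) p])
      (auto simp: operator_mat_def mult.commute intro!: sum.cong)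
  also have "\<dots> = L (from_coords xs v) (ys ! p)"
    using assms(1) unfolding linear_operator_def from_coords_def[abs_def] by simp
  finally show "(operator_mat L ys xs *\<^sub>v v) $ p = coords ys (L (from_coords xs v)) $ p"
    using p by (simp add: coords_def)
qed (simp add: coords_def operator_mat_def)

lemma poly_ring_times: "p \<in> poly_ring X \<Longrightarrow> q \<in> poly_ring X \<Longrightarrow> p * q \<in> poly_ring X"
  using keys_mult[of p q] unfolding poly_ring_def by (fastforce simp: keys_add_exponents)

lemma poly_ring_sum: "(\<And>i. i \<in> I \<Longrightarrow> p i \<in> poly_ring X) \<Longrightarrow> (\<Sum>i\<in>I. p i) \<in> poly_ring X"
  using keys_sum[of p I] unfolding poly_ring_def by blast

lemma graded_map_entry_poly_ring:
  "graded_map X a b A \<Longrightarrow> p < length a \<Longrightarrow> q < length b \<Longrightarrow> A $$ (p, q) \<in> poly_ring X"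
  using graded_map_entry[of X a b A p q] by (auto simp: homogeneous_def poly_ring_def)

lemma free_module_iff:
  "v \<in> free_module X n \<longleftrightarrow> v \<in> carrier_vec n \<and> (\<forall>q<n. v $ q \<in> poly_ring X)"
  by (auto simp: free_module_def elim!: vec_setE) (metis vec_setI carrier_vecD subsetD)

lemma graded_map_free_module:
  assumes A: "graded_map X a b A" and v: "v \<in> free_module X (length b)"
  shows "A *\<^sub>v v \<in> free_module X (length a)"
  unfolding free_module_iff
proof (intro conjI allI impI)
  have c: "A \<in> carrier_mat (length a) (length b)" "v \<in> carrier_vec (length b)"
    using graded_map_carrier[OF A] v by (auto simp: free_module_iff)
  then show "A *\<^sub>v v \<in> carrier_vec (length a)" by simp
  fix p assume p: "p < length a"
  show "(A *\<^sub>v v) $ p \<in> poly_ring X"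
    unfolding index_mult_mat_vec_sum[OF c p]
    using v p by (intro poly_ring_sum poly_ring_times graded_map_entry_poly_ring[OF A])
      (auto simp: free_module_iff)
qed

lemma graded_map_preimage_free_module:
  assumes A: "graded_map X a b A" and w: "w \<in> carrier_vec (length b)"
    and Aw: "A *\<^sub>v w \<in> free_module X (length a)"
  shows "\<exists>w' \<in> free_module X (length b). A *\<^sub>v w' = A *\<^sub>v w"
proof -
  let ?P = "\<lambda>m. keys m \<subseteq> X"
  let ?w = "vec (length b) (\<lambda>q. restrict_monomials ?P (w $ q))"
  have "A *\<^sub>v ?w = vec (length a) (\<lambda>p. restrict_monomials ?P ((A *\<^sub>v w) $ p))"
  proof (rule mult_mat_vec_restrict_monomials[OF graded_map_carrier[OF A] w])
    fix p q m m' assume "p < length a" "q < length b" "m \<in> keys (A $$ (p, q))"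
    then show "keys (m + m') \<subseteq> X \<longleftrightarrow> keys m' \<subseteq> X"
      using graded_map_entry[OF A] by (auto simp: homogeneous_def keys_add_exponents)
  qed
  also have "\<dots> = A *\<^sub>v w"
  proof (rule eq_vecI)
    fix p assume "p < dim_vec (A *\<^sub>v w)"
    then have p: "p < length a" using graded_map_carrier[OF A] by simp
    then have "(A *\<^sub>v w) $ p \<in> poly_ring X" using Aw by (simp add: free_module_iff)
    then show "vec (length a) (\<lambda>p. restrict_monomials ?P ((A *\<^sub>v w) $ p)) $ p = (A *\<^sub>v w) $ p"
      using p by (simp add: poly_ring_def restrict_monomials_id del: index_mult_mat_vec)
  qed (use graded_map_carrier[OF A] in simp)
  finally show ?thesis
    by (intro bexI[of _ ?w]) (auto simp: free_module_iff poly_ring_restrict_monomials)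
qed

text \<open>Exactness is assumed over the ring of polynomials in all variables; it passes to \<open>\<bbbK>[X]\<close>
  because a preimage can be projected to \<open>\<bbbK>[X]\<close> when the matrix has its entries there.\<close>

lemma resolution_of_operators:
  fixes L :: "nat \<Rightarrow> ('b \<Rightarrow> ('v, 'k::comm_ring_1) mpoly) \<Rightarrow> 'b \<Rightarrow> ('v, 'k) mpoly"
    and bs :: "nat \<Rightarrow> 'b list" and b0 :: 'b and deg :: "'b \<Rightarrow> int"
  defines "ys i \<equiv> (case i of 0 \<Rightarrow> [b0] | Suc j \<Rightarrow> bs j)"
  assumes dist: "\<And>i. distinct (bs i)" and lin: "\<And>i. linear_operator (L i)" and deg0: "deg b0 = 0"
    and maps: "\<And>i f. f \<in> supported_on (bs i) \<Longrightarrow> L i f \<in> supported_on (ys i)"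
    and complex: "\<And>i f. f \<in> supported_on (bs (Suc i)) \<Longrightarrow> L i (L (Suc i) f) = (\<lambda>x. 0)"
    and exact: "\<And>i f. f \<in> supported_on (bs i) \<Longrightarrow> L i f = (\<lambda>x. 0) \<Longrightarrow>
        \<exists>g \<in> supported_on (bs (Suc i)). L (Suc i) g = f"
    and hom: "\<And>i x y. x \<in> set (bs i) \<Longrightarrow> y \<in> set (ys i) \<Longrightarrow>
        homogeneous X (deg x - deg y) (L i (basis_fun x) y)"
  shows "graded_free_resolution X ((\<lambda>f. L 0 f b0) ` supported_on (bs 0) \<inter> poly_ring X)
     \<lparr> shifts = \<lambda>i. map deg (bs i), diff = \<lambda>i. operator_mat (L i) (ys i) (bs i) \<rparr>"
proof -
  let ?D = "\<lambda>i. operator_mat (L i) (ys i) (bs i)"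
  have ys: "ys 0 = [b0]" "ys (Suc i) = bs i" for i by (simp_all add: ys_def)
  have distys: "distinct (ys i)" for i using dist by (cases i) (simp_all add: ys)
  have graded: "graded_map X (map deg (ys i)) (map deg (bs i)) (?D i)" for i
    unfolding graded_map_iff by (auto simp: operator_mat_def hom)
  have coords_image: "from_coords (ys i) (?D i *\<^sub>v v) = L i (from_coords (bs i) v)"
    if "v \<in> carrier_vec (length (bs i))" for i v
    using that by (simp add: operator_mat_mult_vec lin from_coords_coords distys maps from_coords_supported)
  have aug: "(\<lambda>v. ?D 0 *\<^sub>v v) ` free_module X (length (bs 0)) =
      (\<lambda>f. vec 1 (\<lambda>_. f)) ` ((\<lambda>f. L 0 f b0) ` supported_on (bs 0) \<inter> poly_ring X)" (is "?l = ?r")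
  proof (intro subset_antisym subsetI)
    fix u assume "u \<in> ?l"
    then obtain v where v: "v \<in> free_module X (length (bs 0))" "u = ?D 0 *\<^sub>v v" by blast
    then have u: "u = vec 1 (\<lambda>_. L 0 (from_coords (bs 0) v) b0)"
      using lin by (subst v(2), subst operator_mat_mult_vec) (auto simp: free_module_iff coords_def ys)
    have "u \<in> free_module X 1"
      using graded_map_free_module[OF graded[of 0]] v by (simp add: ys)
    then have "L 0 (from_coords (bs 0) v) b0 \<in> poly_ring X" by (simp add: u free_module_iff)
    then show "u \<in> ?r" unfolding u by (intro imageI IntI from_coords_supported)
  next
    fix u assume "u \<in> ?r"
    then obtain f where f: "f \<in> supported_on (bs 0)" "L 0 f b0 \<in> poly_ring X" "u = vec 1 (\<lambda>_. L 0 f b0)"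
      by blast
    have u: "?D 0 *\<^sub>v coords (bs 0) f = u"
      unfolding operator_mat_mult_vec[OF lin coords_carrier] from_coords_coords[OF dist f(1)] f(3)
      by (intro eq_vecI) (auto simp: coords_def ys)
    have "u \<in> free_module X 1" using f by (simp add: free_module_iff)
    then obtain w where "w \<in> free_module X (length (bs 0))" "?D 0 *\<^sub>v w = u"
      using graded_map_preimage_free_module[OF graded[of 0], of "coords (bs 0) f"] u by (auto simp: ys)
    then show "u \<in> ?l" by blast
  qed
  have ex: "(\<lambda>v. ?D (Suc i) *\<^sub>v v) ` free_module X (length (bs (Suc i))) =
      mat_kernel (?D i) \<inter> free_module X (length (bs i))" (is "?l = ?r") for i
  proof (intro subset_antisym subsetI)
    fix u assume "u \<in> ?l"
    then obtain v where v: "v \<in> free_module X (length (bs (Suc i)))" "u = ?D (Suc i) *\<^sub>v v" by blast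
    then have cv: "v \<in> carrier_vec (length (bs (Suc i)))" by (simp add: free_module_iff)
    have u: "u \<in> free_module X (length (bs i))"
      using graded_map_free_module[OF graded[of "Suc i"]] v by (simp add: ys)
    then have cu: "u \<in> carrier_vec (length (bs i))" by (simp add: free_module_iff)
    have "from_coords (bs i) u = L (Suc i) (from_coords (bs (Suc i)) v)"
      using coords_image[OF cv] v(2) by (simp add: ys)
    then have "?D i *\<^sub>v u = coords (ys i) (\<lambda>x. 0)"
      using cu lin by (simp add: operator_mat_mult_vec complex from_coords_supported)
    also have "\<dots> = 0\<^sub>v (length (ys i))" by (intro eq_vecI) (auto simp: coords_def)
    finally have "u \<in> mat_kernel (?D i)" using cu by (intro mat_kernelI[OF operator_mat_carrier])
    then show "u \<in> ?r" using u by blast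
  next
    fix u assume "u \<in> ?r"
    then have u: "u \<in> free_module X (length (bs i))" "?D i *\<^sub>v u = 0\<^sub>v (length (ys i))"
      and cu: "u \<in> carrier_vec (length (bs i))"
      using mat_kernelD[OF operator_mat_carrier] by (auto simp: free_module_iff)
    have "L i (from_coords (bs i) u) = from_coords (ys i) (0\<^sub>v (length (ys i)))"
      using coords_image[OF cu] u(2) by simp
    also have "\<dots> = (\<lambda>x. 0)" by (rule ext) (simp add: from_coords_def)
    finally obtain g where g: "g \<in> supported_on (bs (Suc i))" "L (Suc i) g = from_coords (bs i) u"
      using exact[OF from_coords_supported] by blast
    have "?D (Suc i) *\<^sub>v coords (bs (Suc i)) g = u"
      using g lin dist cu by (simp add: operator_mat_mult_vec from_coords_coords coords_from_coords ys)
    then obtain w where "w \<in> free_module X (length (bs (Suc i)))" "?D (Suc i) *\<^sub>v w = u"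
      using graded_map_preimage_free_module[OF graded[of "Suc i"], of "coords (bs (Suc i)) g"] u(1)
      by (auto simp: ys)
    then show "u \<in> ?l" by blast
  qed
  show ?thesis
    unfolding graded_free_resolution_def
    using graded[of 0] graded[of "Suc _"] aug ex deg0 by (simp add: ys)
qed


section \<open>The Eagon--Northcott resolution\<close>

lemma koszul_linear:
  "koszul n a (\<lambda>T. \<Sum>q<N. c q * f q T) = (\<lambda>T. \<Sum>q<N. c q * koszul n a (f q) T)" for N :: nat
  by (induction N) (simp_all add: koszul_add koszul_mult)

locale graded_coprime_columns = coprime_columns A B n k_type
  for A B :: "nat \<Rightarrow> 'v \<Rightarrow>\<^sub>0 nat" and n :: nat and k_type :: "'k::comm_ring_1 itself" +
  fixes X :: "'v set"
  assumes A_vars: "\<And>j. j < n \<Longrightarrow> keys (A j) \<subseteq> X"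
    and B_vars: "\<And>j. j < n \<Longrightarrow> keys (B j) \<subseteq> X"
    and same_deg: "\<And>j. j < n \<Longrightarrow> total_deg (B j) = total_deg (A j)"
begin

text \<open>The basis vector \<open>(q, T)\<close> of the \<open>i\<close>-th module is \<open>e\<^sub>T\<close> in the \<open>q\<close>-th copy of
  \<open>\<Lambda>\<^sup>i\<^sup>+\<^sup>2 R\<^sup>n\<close>.\<close>

definition en_index :: "nat \<Rightarrow> (nat \<times> nat set) set" where
  "en_index i = {..i} \<times> {T. T \<subseteq> {..<n} \<and> card T = i + 2}"

definition en_basis :: "nat \<Rightarrow> (nat \<times> nat set) list" where
  "en_basis i = (SOME xs. set xs = en_index i \<and> distinct xs)"

lemma en_basis: "set (en_basis i) = en_index i" "distinct (en_basis i)"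
proof -
  have "finite (en_index i)" by (auto simp: en_index_def)
  then have "\<exists>xs. set xs = en_index i \<and> distinct xs" by (rule finite_distinct_list)
  then have "set (en_basis i) = en_index i \<and> distinct (en_basis i)"
    unfolding en_basis_def by (rule someI_ex)
  then show "set (en_basis i) = en_index i" "distinct (en_basis i)" by auto
qed

definition en_degree :: "nat \<times> nat set \<Rightarrow> int" where
  "en_degree x = (\<Sum>j\<in>snd x. int (total_deg (A j)))"

text \<open>Operator \<open>0\<close> is the augmentation \<open>\<partial>\<^sub>a \<partial>\<^sub>b : \<Lambda>\<^sup>2 R\<^sup>n \<rightarrow> R\<close>, with values in the free module on the one
  basis vector \<open>(0, {})\<close>.\<close>

fun en_operator ::
  "nat \<Rightarrow> (nat \<times> nat set \<Rightarrow> ('v, 'k) mpoly) \<Rightarrow> nat \<times> nat set \<Rightarrow> ('v, 'k) mpoly" where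
  "en_operator 0 f (q, T) = (if q = 0 then koszul n row_a (koszul n row_b (\<lambda>U. f (0, U))) T else 0)"
| "en_operator (Suc i) f (q, T) = (if q \<le> i
     then koszul n row_a (\<lambda>U. f (q, U)) T + koszul n row_b (\<lambda>U. f (Suc q, U)) T else 0)"

definition en_resolution :: "('v, 'k) graded_free_seq" where
  "en_resolution = \<lparr> shifts = \<lambda>i. map en_degree (en_basis i),
     diff = \<lambda>i. operator_mat (en_operator i) (case i of 0 \<Rightarrow> [(0, {})] | Suc j \<Rightarrow> en_basis j) (en_basis i) \<rparr>"

lemma supported_on_en_basis:
  "f \<in> supported_on (en_basis i) \<longleftrightarrow>
     (\<forall>q. (\<lambda>T. f (q, T)) \<in> ext_power n (i + 2)) \<and> (\<forall>q>i. \<forall>T. f (q, T) = 0)"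
  unfolding supported_on_def ext_power_def en_basis en_index_def
  by (auto simp: not_le)

lemma row_homogeneous:
  assumes "j < n"
  shows "homogeneous X (int (total_deg (A j))) (row_a j)" "homogeneous X (int (total_deg (A j))) (row_b j)"
  using assms A_vars B_vars same_deg by (auto simp: row_a_def row_b_def intro!: homogeneous_monomial)

lemma koszul_homogeneous:
  fixes a :: "nat \<Rightarrow> ('v, 'k) mpoly"
  assumes a: "\<And>j. j < n \<Longrightarrow> homogeneous X (int (total_deg (A j))) (a j)"
    and f: "\<And>U. finite U \<Longrightarrow> homogeneous X (c - en_degree (q, U)) (f U)" and T: "finite T"
  shows "homogeneous X (c - en_degree (q, T)) (koszul n a f T)"
  unfolding koszul_def
proof (rule homogeneous_sum)
  fix j assume j: "j \<in> {..<n} - T"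
  have "homogeneous X (int (total_deg (A j)) + (c - en_degree (q, insert j T)))
      ((-1) ^ card {i \<in> T. i < j} * a j * f (insert j T))"
    using j T by (intro homogeneous_times homogeneous_sign a f) auto
  moreover have "en_degree (q, insert j T) = int (total_deg (A j)) + en_degree (q, T)"
    using j T by (simp add: en_degree_def)
  ultimately show "homogeneous X (c - en_degree (q, T)) ((-1) ^ card {i \<in> T. i < j} * a j * f (insert j T))"
    by simp
qed

lemma en_operator_homogeneous:
  assumes "finite T"
  shows "homogeneous X (en_degree x - en_degree (q, T)) (en_operator i (basis_fun x) (q, T))"
proof -
  have deg: "en_degree (q, T) = en_degree (q', T)" for q q' T by (simp add: en_degree_def)
  have basis: "homogeneous X (en_degree x - en_degree (q', U)) (basis_fun x (q'', U))" for q' q'' U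
    using homogeneous_one by (cases x) (auto simp: basis_fun_def deg[of q' U q''])
  note K = koszul_homogeneous[OF row_homogeneous(1)] koszul_homogeneous[OF row_homogeneous(2)]
  show ?thesis
    by (cases i) (auto intro!: K basis homogeneous_add assms)
qed

lemma en_operator_linear: "linear_operator (en_operator i)"
  unfolding linear_operator_def
proof (intro allI)
  fix N :: nat and c :: "nat \<Rightarrow> ('v, 'k) mpoly" and f and y :: "nat \<times> nat set"
  obtain q T where y: "y = (q, T)" by force
  show "en_operator i (\<lambda>x. \<Sum>q<N. c q * f q x) y = (\<Sum>q<N. c q * en_operator i (f q) y)"
    by (cases i) (simp_all add: y koszul_linear distrib_left sum.distrib)
qed

lemma koszul_koszul_fun: "koszul n a (koszul n a f) = (\<lambda>T. 0)"
  by (rule ext) (rule koszul_koszul)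

lemma koszul_anticommute_fun: "koszul n row_b (koszul n row_a f) = (\<lambda>T. - koszul n row_a (koszul n row_b f) T)"
  by (rule ext) (rule koszul_anticommute)

lemma en_operator_complex: "en_operator i (en_operator (Suc i) f) = (\<lambda>x. 0)"
proof
  fix x :: "nat \<times> nat set"
  obtain q T where x: "x = (q, T)" by force
  show "en_operator i (en_operator (Suc i) f) x = 0"
    by (cases i) (simp_all add: x koszul_add koszul_uminus koszul_koszul_fun koszul_anticommute_fun)
qed

lemma en_operator_maps:
  assumes "f \<in> supported_on (en_basis i)"
  shows "en_operator i f \<in> supported_on (case i of 0 \<Rightarrow> [(0, {})] | Suc j \<Rightarrow> en_basis j)"
proof (cases i)
  case 0
  have "koszul n row_a (koszul n row_b (\<lambda>U. f (0, U))) \<in> ext_power n 0"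
    using assms 0 by (intro koszul_in_ext_power) (simp add: supported_on_en_basis numeral_2_eq_2)
  then have "koszul n row_a (koszul n row_b (\<lambda>U. f (0, U))) T = 0" if "T \<noteq> {}" for T
    using that finite_subset[of T "{..<n}"] by (auto simp: ext_power_def)
  then show ?thesis by (auto simp: 0 supported_on_def)
next
  case (Suc j)
  have f: "(\<lambda>U. f (q, U)) \<in> ext_power n (Suc (j + 2))" for q
    using assms Suc by (simp add: supported_on_en_basis)
  have "(\<lambda>T. en_operator (Suc j) f (q, T)) \<in> ext_power n (j + 2)" for q
    using ext_power_add[OF koszul_in_ext_power[OF f] koszul_in_ext_power[OF f]] ext_power_zero
    by (cases "q \<le> j") auto
  then show ?thesis by (simp add: Suc supported_on_en_basis)
qed

lemma en_operator_exact:
  assumes f: "f \<in> supported_on (en_basis i)" and 0: "en_operator i f = (\<lambda>x. 0)"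
  shows "\<exists>g \<in> supported_on (en_basis (Suc i)). en_operator (Suc i) g = f"
proof -
  have "\<exists>g. (\<forall>q \<le> Suc i. g q \<in> ext_power n (i + 3)) \<and>
      (\<forall>q \<le> i. \<forall>T. f (q, T) = koszul n row_a (g q) T + koszul n row_b (g (Suc q)) T)"
  proof (rule eagon_northcott_exact)
    show "(\<lambda>T. f (q, T)) \<in> ext_power n (i + 2)" for q
      using f by (simp add: supported_on_en_basis)
    show "koszul n row_a (\<lambda>T. f (q, T)) T + koszul n row_b (\<lambda>T. f (Suc q, T)) T = 0" if "q < i" for q T
      using fun_cong[OF 0, of "(q, T)"] that by (cases i) auto
    show "koszul n row_a (koszul n row_b (\<lambda>T. f (0, T))) = (\<lambda>T. 0)" if "i = 0"
    proof
      fix T show "koszul n row_a (koszul n row_b (\<lambda>T. f (0, T))) T = 0"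
        using fun_cong[OF 0, of "(0, T)"] that by simp
    qed
  qed
  then obtain g where g: "\<And>q. q \<le> Suc i \<Longrightarrow> g q \<in> ext_power n (i + 3)"
    "\<And>q T. q \<le> i \<Longrightarrow> f (q, T) = koszul n row_a (g q) T + koszul n row_b (g (Suc q)) T" by blast
  define G where "G x = (if fst x \<le> Suc i then g (fst x) (snd x) else 0)" for x
  have "(\<lambda>T. G (q, T)) \<in> ext_power n (Suc i + 2)" for q
    using g(1) ext_power_zero by (cases "q \<le> Suc i") (simp_all add: G_def numeral_3_eq_3)
  then have "G \<in> supported_on (en_basis (Suc i))" by (auto simp: supported_on_en_basis G_def)
  moreover have "en_operator (Suc i) G = f"
  proof
    fix x :: "nat \<times> nat set"
    obtain q T where "x = (q, T)" by force
    then show "en_operator (Suc i) G x = f x"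
      using g(2) f by (auto simp: G_def supported_on_en_basis)
  qed
  ultimately show ?thesis by blast
qed

lemma lookup_zero_koszul:
  fixes a :: "nat \<Rightarrow> ('v, 'k) mpoly"
  assumes "\<And>j. j < n \<Longrightarrow> lookup (a j) 0 = 0"
  shows "lookup (koszul n a f T) 0 = 0"
  unfolding koszul_def lookup_sum using assms by (intro sum.neutral) (auto simp: lookup_zero_times)

text \<open>The resolution is minimal since the entries of its differentials are linear combinations of
  the nonconstant monomials in the matrix.\<close>

theorem en_resolution_minimal:
  "minimal_graded_free_resolution X (minors_ideal row_a row_b n \<inter> poly_ring X) en_resolution"
proof -
  have ideal: "(\<lambda>f. en_operator 0 f (0, {})) ` supported_on (en_basis 0) = minors_ideal row_a row_b n"
  proof (intro subset_antisym subsetI)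
    fix p assume "p \<in> minors_ideal row_a row_b n"
    then obtain y where y: "y \<in> ext_power n 2" "p = koszul n row_a (koszul n row_b y) {}"
      by (auto simp: minors_ideal_def)
    let ?f = "\<lambda>x. if fst x = 0 then y (snd x) else 0"
    have "(\<lambda>T. ?f (q, T)) \<in> ext_power n (0 + 2)" for q
      using y(1) ext_power_zero by (cases "q = 0") (simp_all add: numeral_2_eq_2)
    then have "?f \<in> supported_on (en_basis 0)" by (auto simp: supported_on_en_basis)
    then show "p \<in> (\<lambda>f. en_operator 0 f (0, {})) ` supported_on (en_basis 0)"
      using y(2) by (intro image_eqI[of _ _ ?f]) auto
  next
    fix p assume "p \<in> (\<lambda>f. en_operator 0 f (0, {})) ` supported_on (en_basis 0)"
    then obtain f where "f \<in> supported_on (en_basis 0)"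
      "p = koszul n row_a (koszul n row_b (\<lambda>U. f (0, U))) {}" by auto
    then show "p \<in> minors_ideal row_a row_b n"
      unfolding minors_ideal_def
      by (intro CollectI exI[of _ "\<lambda>U. f (0, U)"]) (simp add: supported_on_en_basis numeral_2_eq_2)
  qed
  have "graded_free_resolution X
      ((\<lambda>f. en_operator 0 f (0, {})) ` supported_on (en_basis 0) \<inter> poly_ring X) en_resolution"
    unfolding en_resolution_def
  proof (rule resolution_of_operators)
    show "homogeneous X (en_degree x - en_degree y) (en_operator i (basis_fun x) y)"
      if "y \<in> set (case i of 0 \<Rightarrow> [(0, {})] | Suc j \<Rightarrow> en_basis j)" for i x y
    proof -
      have "finite (snd y)"
        using that finite_subset[of "snd y" "{..<n}"] by (cases i) (auto simp: en_basis en_index_def)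
      then show ?thesis using en_operator_homogeneous[of "snd y" x "fst y" i] by simp
    qed
  qed (auto simp: en_basis en_operator_linear en_operator_maps en_operator_complex en_operator_exact
        en_degree_def)
  moreover have "lookup p 0 = 0" if entry: "p \<in> elements_mat (diff en_resolution (Suc i))" for i p
  proof -
    have D: "diff en_resolution (Suc i) = operator_mat (en_operator (Suc i)) (en_basis i) (en_basis (Suc i))"
      by (simp add: en_resolution_def)
    obtain r c where "r < length (en_basis i)" "c < length (en_basis (Suc i))"
      "p = operator_mat (en_operator (Suc i)) (en_basis i) (en_basis (Suc i)) $$ (r, c)"
      using elements_matD[OF entry[unfolded D]] by (auto simp: operator_mat_def)
    then have "p = en_operator (Suc i) (basis_fun (en_basis (Suc i) ! c)) (en_basis i ! r)"
      by (simp add: operator_mat_def)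
    then obtain x y where "p = en_operator (Suc i) (basis_fun x) y" by (rule that)
    moreover obtain q T where "y = (q, T)" by force
    ultimately have p: "p = en_operator (Suc i) (basis_fun x) (q, T)" by simp
    have "lookup (row_a j) 0 = 0" "lookup (row_b j) 0 = 0" if "j < n" for j
      using A_nonzero[OF that] B_nonzero[OF that] by (auto simp: row_a_def row_b_def lookup_single when_def)
    then show ?thesis by (auto simp: p lookup_add lookup_zero_koszul)
  qed
  ultimately show ?thesis unfolding minimal_graded_free_resolution_def ideal by blast
qed

lemma en_resolution_shifts:
  "set (shifts en_resolution i) = (\<lambda>T. \<Sum>j\<in>T. int (total_deg (A j))) ` {T. T \<subseteq> {..<n} \<and> card T = i + 2}"
  by (force simp: en_resolution_def en_basis en_index_def en_degree_def)

theorem regularity_minors_ideal: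
  "regularity X (minors_ideal row_a row_b n \<inter> poly_ring X) =
     Max {(\<Sum>j\<in>T. int (total_deg (A j))) - int i | i T. T \<subseteq> {..<n} \<and> card T = i + 2}"
proof -
  let ?I = "minors_ideal row_a row_b n \<inter> poly_ring X"
  let ?F = "SOME F. minimal_graded_free_resolution X ?I F"
  have F: "minimal_graded_free_resolution X ?I ?F"
    using en_resolution_minimal by (rule someI)
  have "set (shifts ?F i) = set (shifts en_resolution i)" for i
    using shifts_minimal_subset[OF F] shifts_minimal_subset[OF en_resolution_minimal]
      F en_resolution_minimal unfolding minimal_graded_free_resolution_def by blast
  then have "graded_betti X ?I i j \<noteq> 0 \<longleftrightarrow>
      (\<exists>T. T \<subseteq> {..<n} \<and> card T = i + 2 \<and> j = (\<Sum>j\<in>T. int (total_deg (A j))))" for i j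
    unfolding graded_betti_def count_list_0_iff by (auto simp: en_resolution_shifts)
  then show ?thesis unfolding regularity_def by (intro arg_cong[of _ _ Max]) auto
qed

end


section \<open>Toric ideals of graphs as lattice ideals\<close>

text \<open>The exponent of the image of the monomial with exponent \<open>m\<close> under \<open>{u, w} \<mapsto> u w\<close>.\<close>

definition vertex_exponent :: "('v set \<Rightarrow>\<^sub>0 nat) \<Rightarrow> ('v \<Rightarrow>\<^sub>0 nat)" where
  "vertex_exponent m = (\<Sum>e\<in>keys m. \<Sum>v\<in>e. monomial v (lookup m e))"

lemma prod_monomials: "(\<Prod>i\<in>S. monomial (f i) 1) = (monomial (\<Sum>i\<in>S. f i) 1 :: ('v, 'k::comm_ring_1) mpoly)"
  by (induction S rule: infinite_finite_induct) (simp_all add: mult_single)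

lemma Var_power: "Var v ^ k = (monomial (monomial v k) 1 :: ('v, 'k::comm_ring_1) mpoly)"
  by (induction k) (simp_all add: Var_def mult_single single_add[symmetric])

lemma lookup_poly_subst_edges:
  "lookup (poly_subst (\<lambda>e. \<Prod>v\<in>e. Var v) p) c = class_sum (\<lambda>m. vertex_exponent m = c) p"
proof -
  have "poly_subst (\<lambda>e. \<Prod>v\<in>e. Var v) p = (\<Sum>m\<in>keys p. monomial (vertex_exponent m) (lookup p m))"
    by (simp add: poly_subst_def prod_power_distrib Var_power prod_monomials Const_def
        mult_single vertex_exponent_def)
  then show ?thesis
    by (simp add: class_sum_def lookup_sum lookup_single when_def sum.If_cases Int_def conj_commute)
qed

lemma class_sum_cong: "(\<And>m. m \<in> keys p \<Longrightarrow> C m \<longleftrightarrow> D m) \<Longrightarrow> class_sum C p = class_sum D p"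
  unfolding class_sum_def by (intro sum.cong) auto

lemma lookup_vertex_exponent:
  assumes "finite S" "keys m \<subseteq> S" "\<And>e. e \<in> S \<Longrightarrow> finite e"
  shows "lookup (vertex_exponent m) v = (\<Sum>e\<in>S. if v \<in> e then lookup m e else 0)"
proof -
  have "lookup (vertex_exponent m) v = (\<Sum>e\<in>keys m. if v \<in> e then lookup m e else 0)"
    unfolding vertex_exponent_def lookup_sum
  proof (intro sum.cong refl)
    fix e assume "e \<in> keys m"
    then have "finite e" using assms by auto
    then show "(\<Sum>u\<in>e. lookup (monomial u (lookup m e)) v) = (if v \<in> e then lookup m e else 0)"
      by (simp add: lookup_single when_def)
  qed
  also have "\<dots> = (\<Sum>e\<in>S. if v \<in> e then lookup m e else 0)"
    by (rule sum.mono_neutral_left) (use assms in \<open>auto simp: in_keys_iff\<close>)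
  finally show ?thesis .
qed

text \<open>A polynomial is killed by a monomial map iff its coefficients sum to \<open>0\<close> over every fibre of
  the map on exponents; hence the kernel is determined by the fibres.\<close>

lemma toric_ideal_eq_lattice_ideal:
  assumes "\<And>m m'. keys m \<subseteq> snd G \<Longrightarrow> keys m' \<subseteq> snd G \<Longrightarrow>
      vertex_exponent m = vertex_exponent m' \<longleftrightarrow> lattice_cong A B n m m'"
  shows "toric_ideal G = lattice_ideal A B n \<inter> poly_ring (snd G)"
proof -
  have "poly_subst (\<lambda>e. \<Prod>v\<in>e. Var v) p = 0 \<longleftrightarrow> p \<in> lattice_ideal A B n"
    if p: "p \<in> poly_ring (snd G)" for p :: "('a set, 'b::comm_ring_1) mpoly"
  proof -
    have eq: "class_sum (lattice_cong A B n m) p = class_sum (\<lambda>m'. vertex_exponent m' = vertex_exponent m) p"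
      if "m \<in> keys p" for m
      using p that assms[of m] by (intro class_sum_cong) (fastforce simp: poly_ring_def)
    have "class_sum (lattice_cong A B n m) p = 0" if "\<forall>c. class_sum (\<lambda>m. vertex_exponent m = c) p = 0" for m
    proof (rule ccontr)
      assume nz: "class_sum (lattice_cong A B n m) p \<noteq> 0"
      then obtain m' where "m' \<in> keys p" "lattice_cong A B n m m'" using class_sum_nonzeroD by blast
      then show False using nz that eq[of m'] lattice_cong_class[of A B n m m'] by simp
    qed
    moreover have "class_sum (\<lambda>m. vertex_exponent m = c) p = 0"
      if "\<forall>m. class_sum (lattice_cong A B n m) p = 0" for c
    proof (rule ccontr)
      assume nz: "class_sum (\<lambda>m. vertex_exponent m = c) p \<noteq> 0"
      then obtain m' where "m' \<in> keys p" "vertex_exponent m' = c" using class_sum_nonzeroD by blast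
      then show False using nz that eq[of m'] by simp
    qed
    ultimately show ?thesis
      unfolding lattice_ideal_def poly_mapping_eq_iff fun_eq_iff lookup_poly_subst_edges by auto
  qed
  then show ?thesis unfolding toric_ideal_def by blast
qed


section \<open>The graph as a matrix of monomials\<close>

definition path_vertex :: "nat \<Rightarrow> nat \<Rightarrow> vertex" where
  "path_vertex r k = (if k = 0 then vx 1 else if k = 2 * r - 2 then vx 2 else vz k)"

definition path_edge :: "nat \<Rightarrow> nat \<Rightarrow> vertex set" where
  "path_edge r k = {path_vertex r k, path_vertex r (Suc k)}"

text \<open>Column \<open>j \<ge> 1\<close> of the matrix is \<open>({x\<^sub>1, y\<^sub>j}, {x\<^sub>2, y\<^sub>j})\<close>, and column \<open>0\<close> consists of the products
  of every other edge of the path, beginning with the first and the second edge. In each column the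
  images of the two monomials in the ring of the vertices are proportional to \<open>x\<^sub>1\<close> and \<open>x\<^sub>2\<close>.\<close>

definition column_a :: "nat \<Rightarrow> nat \<Rightarrow> vertex set \<Rightarrow>\<^sub>0 nat" where
  "column_a r j = (if j = 0 then \<Sum>k<r - 1. monomial (path_edge r (2 * k)) 1 else monomial {vx 1, vy j} 1)"

definition column_b :: "nat \<Rightarrow> nat \<Rightarrow> vertex set \<Rightarrow>\<^sub>0 nat" where
  "column_b r j = (if j = 0 then \<Sum>k<r - 1. monomial (path_edge r (2 * k + 1)) 1 else monomial {vx 2, vy j} 1)"

lemma path_vertex_eq_iff:
  "k \<le> 2 * r - 2 \<Longrightarrow> l \<le> 2 * r - 2 \<Longrightarrow> path_vertex r k = path_vertex r l \<longleftrightarrow> k = l"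
  by (auto simp: path_vertex_def)

lemma path_edge_eq_iff:
  "k < 2 * r - 2 \<Longrightarrow> l < 2 * r - 2 \<Longrightarrow> path_edge r k = path_edge r l \<longleftrightarrow> k = l"
  by (auto simp: path_edge_def doubleton_eq_iff path_vertex_eq_iff)

lemma vy_notin_path_edge: "vy j \<notin> path_edge r k"
  by (auto simp: path_edge_def path_vertex_def)

lemma path_edge_neq: "path_edge r k \<noteq> {u, vy j}" "{u, vy j} \<noteq> path_edge r k"
  using vy_notin_path_edge[of j r k] by auto

lemma edges_G_rd:
  assumes "r \<ge> 3"
  shows "snd (G_rd r d) = (\<lambda>j. {vx 1, vy j}) ` {1..d} \<union> (\<lambda>j. {vx 2, vy j}) ` {1..d} \<union> path_edge r ` {..<2 * r - 2}"
proof -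
  have 12: "{1..2} = {1, 2::nat}" by auto
  have "{..<2 * r - 2} = {0} \<union> {1..2 * r - 4} \<union> {2 * r - 3}" using assms by auto
  then have "path_edge r ` {..<2 * r - 2} =
      {path_edge r 0} \<union> path_edge r ` {1..2 * r - 4} \<union> {path_edge r (2 * r - 3)}" by auto
  moreover have "path_edge r 0 = {vx 1, vz 1}" "path_edge r (2 * r - 3) = {vz (2 * r - 3), vx 2}"
    using assms by (auto simp: path_edge_def path_vertex_def)
  moreover have "path_edge r ` {1..2 * r - 4} = {{vz k, vz (k + 1)} | k. k \<in> {1..2 * r - 4}}"
    using assms by (auto simp: path_edge_def path_vertex_def image_iff) force+
  moreover have "{{vx i, vy j} | i j. i \<in> {1..2} \<and> j \<in> {1..d}} =
      (\<lambda>j. {vx 1, vy j}) ` {1..d} \<union> (\<lambda>j. {vx 2, vy j}) ` {1..d}"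
    unfolding 12 by (auto; blast)
  ultimately show ?thesis unfolding G_rd_def by auto
qed

lemma sum_edges_G_rd:
  assumes "r \<ge> 3"
  shows "(\<Sum>e\<in>snd (G_rd r d). f e) =
    (\<Sum>j=1..d. f {vx 1, vy j}) + (\<Sum>j=1..d. f {vx 2, vy j}) + (\<Sum>k<2 * r - 2. f (path_edge r k))"
proof -
  let ?E1 = "(\<lambda>j. {vx 1, vy j}) ` {1..d}" and ?E2 = "(\<lambda>j. {vx 2, vy j}) ` {1..d}"
    and ?P = "path_edge r ` {..<2 * r - 2}"
  have "{vx 1, vy i} \<noteq> {vx 2, vy j}" for i j by (simp add: doubleton_eq_iff)
  then have "?E1 \<inter> ?E2 = {}" by blast
  moreover have "{vx 1, vy j} \<noteq> path_edge r k" "{vx 2, vy j} \<noteq> path_edge r k" for j k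
    by (rule path_edge_neq)+
  then have "(?E1 \<union> ?E2) \<inter> ?P = {}" by blast
  ultimately have "(\<Sum>e\<in>snd (G_rd r d). f e) = sum f ?E1 + sum f ?E2 + sum f ?P"
    unfolding edges_G_rd[OF assms] by (simp add: sum.union_disjoint)
  also have "sum f ((\<lambda>j. {vx 1, vy j}) ` {1..d}) = (\<Sum>j=1..d. f {vx 1, vy j})"
    by (subst sum.reindex) (auto simp: inj_on_def doubleton_eq_iff)
  also have "sum f ((\<lambda>j. {vx 2, vy j}) ` {1..d}) = (\<Sum>j=1..d. f {vx 2, vy j})"
    by (subst sum.reindex) (auto simp: inj_on_def doubleton_eq_iff)
  also have "sum f (path_edge r ` {..<2 * r - 2}) = (\<Sum>k<2 * r - 2. f (path_edge r k))"
    by (subst sum.reindex) (auto simp: inj_on_def path_edge_eq_iff)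
  finally show ?thesis .
qed

lemma lookup_column_xy:
  assumes "i \<ge> 1"
  shows "lookup (column_a r j) {vx 1, vy i} = (if i = j then 1 else 0)"
    "lookup (column_a r j) {vx 2, vy i} = 0"
    "lookup (column_b r j) {vx 2, vy i} = (if i = j then 1 else 0)"
    "lookup (column_b r j) {vx 1, vy i} = 0"
  using assms
  by (auto simp: column_a_def column_b_def lookup_sum lookup_single when_def path_edge_neq doubleton_eq_iff)

lemma lookup_column_path:
  assumes "l < 2 * r - 2"
  shows "lookup (column_a r j) (path_edge r l) = (if j = 0 \<and> even l then 1 else 0)"
    "lookup (column_b r j) (path_edge r l) = (if j = 0 \<and> odd l then 1 else 0)"
proof -
  have "(\<Sum>k<r - 1. lookup (monomial (path_edge r (2 * k)) (1::nat)) (path_edge r l)) =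
      (\<Sum>k<r - 1. if 2 * k = l then 1 else 0)"
    using assms by (intro sum.cong refl) (auto simp: lookup_single when_def path_edge_eq_iff)
  also have "\<dots> = (\<Sum>k<r - 1. if even l \<and> k = l div 2 then 1 else 0)"
    by (intro sum.cong refl) auto
  also have "\<dots> = (if even l then 1 else 0)" using assms by auto
  finally show "lookup (column_a r j) (path_edge r l) = (if j = 0 \<and> even l then 1 else 0)"
    by (auto simp: column_a_def lookup_sum lookup_single when_def path_edge_neq)
  have "(\<Sum>k<r - 1. lookup (monomial (path_edge r (2 * k + 1)) (1::nat)) (path_edge r l)) =
      (\<Sum>k<r - 1. if 2 * k + 1 = l then 1 else 0)"
    using assms by (intro sum.cong refl) (auto simp: lookup_single when_def path_edge_eq_iff)
  also have "\<dots> = (\<Sum>k<r - 1. if odd l \<and> k = l div 2 then 1 else 0)"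
    by (intro sum.cong refl) auto
  also have "\<dots> = (if odd l then 1 else 0)" using assms by auto
  finally show "lookup (column_b r j) (path_edge r l) = (if j = 0 \<and> odd l then 1 else 0)"
    by (auto simp: column_b_def lookup_sum lookup_single when_def path_edge_neq)
qed

lemma keys_columns:
  assumes "r \<ge> 3" "j \<le> d"
  shows "keys (column_a r j) \<subseteq> snd (G_rd r d)" "keys (column_b r j) \<subseteq> snd (G_rd r d)"
proof -
  have path: "path_edge r k \<in> snd (G_rd r d)" if "k < 2 * r - 2" for k
    using that by (auto simp: edges_G_rd[OF assms(1)])
  have "keys (column_a r 0) \<subseteq> (\<Union>k<r - 1. {path_edge r (2 * k)})"
    "keys (column_b r 0) \<subseteq> (\<Union>k<r - 1. {path_edge r (2 * k + 1)})"
    unfolding column_a_def column_b_def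
    using keys_sum[of "\<lambda>k. monomial (path_edge r (2 * k)) (1::nat)" "{..<r - 1}"]
      keys_sum[of "\<lambda>k. monomial (path_edge r (2 * k + 1)) (1::nat)" "{..<r - 1}"] by auto
  moreover have "path_edge r (2 * k) \<in> snd (G_rd r d)" "path_edge r (2 * k + 1) \<in> snd (G_rd r d)"
    if "k < r - 1" for k
    using that by (auto intro!: path)
  ultimately have "keys (column_a r 0) \<subseteq> snd (G_rd r d)" "keys (column_b r 0) \<subseteq> snd (G_rd r d)"
    by blast+
  then show "keys (column_a r j) \<subseteq> snd (G_rd r d)" "keys (column_b r j) \<subseteq> snd (G_rd r d)"
    using assms(2) by (cases "j = 0"; simp add: column_a_def column_b_def edges_G_rd[OF assms(1)])+
qed

lemma edge_cases [consumes 2, case_names x1 x2 path]: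
  assumes "e \<in> snd (G_rd r d)" "r \<ge> 3"
  obtains i where "1 \<le> i" "i \<le> d" "e = {vx 1, vy i}" | i where "1 \<le> i" "i \<le> d" "e = {vx 2, vy i}"
    | l where "l < 2 * r - 2" "e = path_edge r l"
  using assms(1) unfolding edges_G_rd[OF assms(2)] by auto

lemma total_deg_variable: "total_deg (monomial v 1) = 1"
  by (simp add: total_deg_def)

lemma total_deg_sum_variables: "total_deg (\<Sum>k<N. monomial (f k) 1) = N" for N :: nat
  by (induction N) (simp_all add: total_deg_zero total_deg_add total_deg_variable[simplified])

lemma total_deg_columns:
  "total_deg (column_a r j) = (if j = 0 then r - 1 else 1)"
  "total_deg (column_b r j) = (if j = 0 then r - 1 else 1)"
  unfolding column_a_def column_b_def
  by (cases "j = 0"; simp only: if_True if_False total_deg_sum_variables total_deg_variable)+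

lemma graded_coprime_columns_G_rd:
  assumes r: "r \<ge> 3"
  shows "graded_coprime_columns (column_a r) (column_b r) (Suc d) (snd (G_rd r d))"
proof
  note look = lookup_column_xy lookup_column_path
  have in_edges: "e \<in> snd (G_rd r d)" if "e \<in> keys (column_a r j) \<or> e \<in> keys (column_b r j)" "j < Suc d" for e j
    using that keys_columns[OF r, of j d] by auto
  fix i j assume ij: "i < Suc d"  "j < Suc d"
  show "keys (column_a r i) \<inter> keys (column_b r j) = {}"
  proof (rule ccontr)
    assume "\<not> ?thesis"
    then obtain e where e: "e \<in> keys (column_a r i)" "e \<in> keys (column_b r j)" by blast
    then have "e \<in> snd (G_rd r d)" using in_edges ij by blast
    then show False using r
      by (cases rule: edge_cases) (use e in \<open>auto simp: in_keys_iff look simp del: One_nat_def split: if_splits\<close>)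
  qed
  show "keys (column_a r i) \<inter> keys (column_a r j) = {}" if "i \<noteq> j"
  proof (rule ccontr)
    assume "\<not> ?thesis"
    then obtain e where e: "e \<in> keys (column_a r i)" "e \<in> keys (column_a r j)" by blast
    then have "e \<in> snd (G_rd r d)" using in_edges ij by blast
    then show False using r
      by (cases rule: edge_cases) (use e that in \<open>auto simp: in_keys_iff look simp del: One_nat_def split: if_splits\<close>)
  qed
  show "keys (column_b r i) \<inter> keys (column_b r j) = {}" if "i \<noteq> j"
  proof (rule ccontr)
    assume "\<not> ?thesis"
    then obtain e where e: "e \<in> keys (column_b r i)" "e \<in> keys (column_b r j)" by blast
    then have "e \<in> snd (G_rd r d)" using in_edges ij by blast
    then show False using r
      by (cases rule: edge_cases) (use e that in \<open>auto simp: in_keys_iff look simp del: One_nat_def split: if_splits\<close>)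
  qed
next
  fix j assume j: "j < Suc d"
  have "total_deg (column_a r j) \<noteq> 0" "total_deg (column_b r j) \<noteq> 0"
    using r by (simp_all add: total_deg_columns)
  then show "column_a r j \<noteq> 0" "column_b r j \<noteq> 0" using total_deg_zero by metis+
  show "keys (column_a r j) \<subseteq> snd (G_rd r d)" "keys (column_b r j) \<subseteq> snd (G_rd r d)"
    using keys_columns[OF r] j by auto
  show "total_deg (column_b r j) = total_deg (column_a r j)" by (simp add: total_deg_columns)
qed

lemma sum_single_nonzero:
  "finite S \<Longrightarrow> i \<in> S \<Longrightarrow> (\<And>j. j \<in> S \<Longrightarrow> j \<noteq> i \<Longrightarrow> f j = 0) \<Longrightarrow> sum f S = f i"
  by (subst sum.mono_neutral_right[of S "{i}"]) auto

text \<open>Every edge occurs in one column only, so that a lattice vector shows its coefficients: that of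
  column \<open>j\<close> on the edges at \<open>y\<^sub>j\<close>, and that of column \<open>0\<close>, with alternating signs, along the path.\<close>

lemma lattice_vector:
  fixes t :: "nat \<Rightarrow> int" and r d :: nat
  defines "s e \<equiv> (\<Sum>j<Suc d. t j * (int (lookup (column_a r j) e) - int (lookup (column_b r j) e)))"
  shows "1 \<le> i \<Longrightarrow> i \<le> d \<Longrightarrow> s {vx 1, vy i} = t i"
    "1 \<le> i \<Longrightarrow> i \<le> d \<Longrightarrow> s {vx 2, vy i} = - t i"
    "l < 2 * r - 2 \<Longrightarrow> s (path_edge r l) = (if even l then t 0 else - t 0)"
proof -
  show "s {vx 1, vy i} = t i" if "1 \<le> i" "i \<le> d"
    unfolding s_def using that by (subst sum_single_nonzero[of _ i]) (auto simp: lookup_column_xy simp del: One_nat_def)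
  show "s {vx 2, vy i} = - t i" if "1 \<le> i" "i \<le> d"
    unfolding s_def using that by (subst sum_single_nonzero[of _ i]) (auto simp: lookup_column_xy simp del: One_nat_def)
  show "s (path_edge r l) = (if even l then t 0 else - t 0)" if "l < 2 * r - 2"
    unfolding s_def using that by (subst sum_single_nonzero[of _ 0]) (auto simp: lookup_column_path)
qed

lemma vertex_sum_G_rd:
  fixes D :: "vertex set \<Rightarrow> int" and r d :: nat
  assumes r: "r \<ge> 3"
  defines "N v \<equiv> \<Sum>e\<in>snd (G_rd r d). if v \<in> e then D e else 0"
  shows "l \<le> 2 * r - 2 \<Longrightarrow> N (path_vertex r l) =
      (if l = 0 then \<Sum>j=1..d. D {vx 1, vy j} else 0) + (if l = 2 * r - 2 then \<Sum>j=1..d. D {vx 2, vy j} else 0) +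
      (if l < 2 * r - 2 then D (path_edge r l) else 0) + (if l = 0 then 0 else D (path_edge r (l - 1)))"
    "j \<in> {1..d} \<Longrightarrow> N (vy j) = D {vx 1, vy j} + D {vx 2, vy j}"
    "v \<notin> path_vertex r ` {..2 * r - 2} \<Longrightarrow> v \<notin> vy ` {1..d} \<Longrightarrow> N v = 0"
proof -
  have N: "N v = (\<Sum>j=1..d. if v \<in> {vx 1, vy j} then D {vx 1, vy j} else 0) +
      (\<Sum>j=1..d. if v \<in> {vx 2, vy j} then D {vx 2, vy j} else 0) +
      (\<Sum>k<2 * r - 2. if v \<in> path_edge r k then D (path_edge r k) else 0)" for v
    unfolding N_def by (rule sum_edges_G_rd[OF r])
  show "N (path_vertex r l) =
      (if l = 0 then \<Sum>j=1..d. D {vx 1, vy j} else 0) + (if l = 2 * r - 2 then \<Sum>j=1..d. D {vx 2, vy j} else 0) +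
      (if l < 2 * r - 2 then D (path_edge r l) else 0) + (if l = 0 then 0 else D (path_edge r (l - 1)))"
    if l: "l \<le> 2 * r - 2"
  proof -
    have 1: "path_vertex r l \<in> {vx 1, vy j} \<longleftrightarrow> l = 0" "path_vertex r l \<in> {vx 2, vy j} \<longleftrightarrow> l = 2 * r - 2" for j
      using r by (auto simp: path_vertex_def)
    have "(\<Sum>k<2 * r - 2. if path_vertex r l \<in> path_edge r k then D (path_edge r k) else 0) =
        (\<Sum>k<2 * r - 2. (if k = l then D (path_edge r l) else 0) + (if l \<noteq> 0 \<and> k = l - 1 then D (path_edge r (l - 1)) else 0))"
      using l by (intro sum.cong refl) (auto simp: path_edge_def path_vertex_eq_iff)
    also have "\<dots> = (if l < 2 * r - 2 then D (path_edge r l) else 0) + (if l = 0 then 0 else D (path_edge r (l - 1)))"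
      using l by (auto simp: sum.distrib)
    finally show ?thesis unfolding N 1 by simp
  qed
  show "N (vy j) = D {vx 1, vy j} + D {vx 2, vy j}" if "j \<in> {1..d}"
    unfolding N using that by (simp add: vy_notin_path_edge)
  show "N v = 0" if v: "v \<notin> path_vertex r ` {..2 * r - 2}" "v \<notin> vy ` {1..d}"
  proof -
    have "v \<noteq> path_vertex r 0" "v \<noteq> path_vertex r (2 * r - 2)" using v by auto
    then have "v \<noteq> vx 1" "v \<noteq> vx 2" using r by (auto simp: path_vertex_def)
    then have 1: "(\<Sum>j=1..d. if v \<in> {vx 1, vy j} then D {vx 1, vy j} else 0) = 0"
      "(\<Sum>j=1..d. if v \<in> {vx 2, vy j} then D {vx 2, vy j} else 0) = 0"
      using v(2) by (auto intro!: sum.neutral)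
    have "v \<notin> path_edge r k" if "k < 2 * r - 2" for k
      using that v unfolding path_edge_def by auto
    then have 2: "(\<Sum>k<2 * r - 2. if v \<in> path_edge r k then D (path_edge r k) else 0) = 0" by simp
    show ?thesis unfolding N 1 2 by simp
  qed
qed

text \<open>Two monomials have the same image iff their difference has vertex sums \<open>0\<close>. The sums at
  \<open>y\<^sub>j\<close> and at the inner vertices of the path say that it is a combination of the columns, and the
  sum at \<open>x\<^sub>1\<close> that the coefficients add up to \<open>0\<close>.\<close>

lemma vertex_exponent_G_rd_iff:
  assumes r: "r \<ge> 3" and m: "keys m \<subseteq> snd (G_rd r d)" "keys m' \<subseteq> snd (G_rd r d)"
  shows "vertex_exponent m = vertex_exponent m' \<longleftrightarrow> lattice_cong (column_a r) (column_b r) (Suc d) m m'"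
proof -
  define D where "D e = int (lookup m' e) - int (lookup m e)" for e
  define N where "N v = (\<Sum>e\<in>snd (G_rd r d). if v \<in> e then D e else 0)" for v
  note N_eq = vertex_sum_G_rd[OF r, where D = D and d = d, folded N_def]
  let ?s = "\<lambda>t e. \<Sum>j<Suc d. t j * (int (lookup (column_a r j) e) - int (lookup (column_b r j) e))"
  have fin: "finite (snd (G_rd r d))" unfolding edges_G_rd[OF r] by simp
  have fine: "finite e" if "e \<in> snd (G_rd r d)" for e
    using that unfolding edges_G_rd[OF r] path_edge_def by auto
  have look: "lookup (vertex_exponent k) v = (\<Sum>e\<in>snd (G_rd r d). if v \<in> e then lookup k e else 0)"
    if "keys k \<subseteq> snd (G_rd r d)" for k v
    by (rule lookup_vertex_exponent[OF fin that]) (rule fine)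
  have "N v = int (lookup (vertex_exponent m') v) - int (lookup (vertex_exponent m) v)" for v
    unfolding look[OF m(1)] look[OF m(2)] of_nat_sum N_def D_def sum_subtractf[symmetric]
    by (intro sum.cong) auto
  then have iff1: "vertex_exponent m = vertex_exponent m' \<longleftrightarrow> (\<forall>v. N v = 0)"
    by (auto simp: poly_mapping_eq_iff fun_eq_iff)
  have sum_split: "(\<Sum>j<Suc d. t j) = t 0 + (\<Sum>j=1..d. t j)" for t :: "nat \<Rightarrow> int"
    by (simp add: lessThan_Suc_atMost atMost_atLeast0 sum.atLeast_Suc_atMost)
  have "(\<exists>t. (\<Sum>j<Suc d. t j) = 0 \<and> (\<forall>e. D e = ?s t e)) \<longleftrightarrow> (\<forall>v. N v = 0)"
  proof
    assume "\<exists>t. (\<Sum>j<Suc d. t j) = 0 \<and> (\<forall>e. D e = ?s t e)"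
    then obtain t where t: "(\<Sum>j<Suc d. t j) = 0" "\<And>e. D e = ?s t e" by blast
    have D1: "D {vx 1, vy i} = t i" if "i \<in> {1..d}" for i
      unfolding t(2) by (rule lattice_vector(1)) (use that in auto)
    have D2: "D {vx 2, vy i} = - t i" if "i \<in> {1..d}" for i
      unfolding t(2) by (rule lattice_vector(2)) (use that in auto)
    have Dp: "D (path_edge r l) = (if even l then t 0 else - t 0)" if "l < 2 * r - 2" for l
      unfolding t(2) by (rule lattice_vector(3)) (rule that)
    have S: "(\<Sum>j=1..d. D {vx 1, vy j}) = - t 0" "(\<Sum>j=1..d. D {vx 2, vy j}) = t 0"
    proof -
      have "(\<Sum>j=1..d. D {vx 1, vy j}) = (\<Sum>j=1..d. t j)" by (intro sum.cong refl D1)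
      moreover have "(\<Sum>j=1..d. D {vx 2, vy j}) = (\<Sum>j=1..d. - t j)" by (intro sum.cong refl D2)
      ultimately show "(\<Sum>j=1..d. D {vx 1, vy j}) = - t 0" "(\<Sum>j=1..d. D {vx 2, vy j}) = t 0"
        using t(1) unfolding sum_split by (simp_all only: sum_negf)
    qed
    show "\<forall>v. N v = 0"
    proof
      fix v
      consider l where "l \<le> 2 * r - 2" "v = path_vertex r l" | j where "j \<in> {1..d}" "v = vy j"
        | "v \<notin> path_vertex r ` {..2 * r - 2}" "v \<notin> vy ` {1..d}" by (meson atMost_iff imageE)
      then show "N v = 0"
      proof cases
        case 1
        then show ?thesis unfolding 1(2) N_eq(1)[OF 1(1)] S using r by (auto simp: Dp)
      qed (auto simp: N_eq D1 D2 simp del: One_nat_def)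
    qed
  next
    assume N0: "\<forall>v. N v = 0"
    define t where "t j = (if j = 0 then D (path_edge r 0) else D {vx 1, vy j})" for j
    have x2: "D {vx 2, vy i} = - t i" if "i \<in> {1..d}" for i
      using N_eq(2)[OF that] N0 that by (auto simp: t_def simp del: One_nat_def)
    have path: "D (path_edge r l) = (if even l then t 0 else - t 0)" if "l < 2 * r - 2" for l
      using that
    proof (induction l)
      case (Suc l)
      then show ?case using N_eq(1)[of "Suc l"] N0 by (auto simp del: One_nat_def)
    qed (simp add: t_def)
    have "N (path_vertex r 0) = t 0 + (\<Sum>j=1..d. t j)"
      using r by (simp add: N_eq(1) t_def del: One_nat_def)
    then have "(\<Sum>j<Suc d. t j) = 0" using N0 by (simp add: sum_split del: sum.lessThan_Suc)
    moreover have "D e = ?s t e" for e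
    proof (cases "e \<in> snd (G_rd r d)")
      case True
      then show ?thesis using r
        by (cases rule: edge_cases)
          (simp_all add: lattice_vector x2 path del: sum.lessThan_Suc One_nat_def, simp add: t_def)
    next
      case False
      then have "lookup m e = 0" "lookup m' e = 0" using m by (auto simp: in_keys_iff)
      moreover have "lookup (column_a r j) e = 0" "lookup (column_b r j) e = 0" if "j < Suc d" for j
        using False keys_columns[OF r, of j d] that by (auto simp: in_keys_iff)
      ultimately show ?thesis by (simp add: D_def del: sum.lessThan_Suc)
    qed
    ultimately show "\<exists>t. (\<Sum>j<Suc d. t j) = 0 \<and> (\<forall>e. D e = ?s t e)" by blast
  qed
  then show ?thesis
    unfolding iff1 lattice_cong_def D_def by (simp add: algebra_simps del: sum.lessThan_Suc)
qed

theorem theorem6p24: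
  fixes r d :: nat
  assumes "d \<ge> 1" and "r \<ge> 3"
  shows "regularity (snd (G_rd r d))
           (toric_ideal (G_rd r d) :: (vertex set, 'k::{alg_closed_field, field_char_0}) mpoly set) = int r"
proof -
  interpret graded_coprime_columns "column_a r" "column_b r" "Suc d" "TYPE('k)" "snd (G_rd r d)"
    by (rule graded_coprime_columns_G_rd) fact
  have "(toric_ideal (G_rd r d) :: (vertex set, 'k) mpoly set) =
      lattice_ideal (column_a r) (column_b r) (Suc d) \<inter> poly_ring (snd (G_rd r d))"
    by (rule toric_ideal_eq_lattice_ideal) (rule vertex_exponent_G_rd_iff[OF assms(2)])
  also have "\<dots> = minors_ideal row_a row_b (Suc d) \<inter> poly_ring (snd (G_rd r d))"
    by (simp only: lattice_ideal_eq_minors_ideal[OF order_refl])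
  finally have "regularity (snd (G_rd r d)) (toric_ideal (G_rd r d) :: (vertex set, 'k) mpoly set) =
      Max {(\<Sum>j\<in>T. int (total_deg (column_a r j))) - int i | i T. T \<subseteq> {..<Suc d} \<and> card T = i + 2}"
    (is "_ = Max ?S") by (simp only: regularity_minors_ideal)
  also have "\<dots> = int r"
  proof (rule Max_eqI)
    have val: "(\<Sum>j\<in>T. int (total_deg (column_a r j))) - int i = (if 0 \<in> T then int r else 2)"
      if "T \<subseteq> {..<Suc d}" "card T = i + 2" for i T
    proof -
      have T: "finite T" using that finite_subset by blast
      have "(\<Sum>j\<in>T. int (total_deg (column_a r j))) = (\<Sum>j\<in>T. 1 + (if j = 0 then int r - 2 else 0))"
        using assms(2) by (intro sum.cong refl) (auto simp: total_deg_columns)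
      also have "\<dots> = int (card T) + (if 0 \<in> T then int r - 2 else 0)"
        using T by (simp add: sum.distrib)
      finally show ?thesis using that by auto
    qed
    then have sub: "?S \<subseteq> {int r, 2}" by auto
    then show "finite ?S" by (rule finite_subset) simp
    show "y \<le> int r" if "y \<in> ?S" for y
    proof -
      have "y \<in> {int r, 2}" using that sub by blast
      then show ?thesis using assms(2) by auto
    qed
    show "int r \<in> ?S"
      using val[of "{0, 1}" 0] assms(1)
      by (intro CollectI exI[of _ 0] exI[of _ "{0, 1}"]) auto
  qed
  finally show ?thesis .
qed

end
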